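(* Let $\mu\in X_{\mathrm{af}}^0(\lambda)$ and $w:=\mathrm{cl}(\mu)\in W^J$. If $\mu\lessdot\nu$ is a cover in the level-zero weight poset $X_{\mathrm{af}}^0(\lambda)$ labeled by $\beta\in\Phi^{\mathrm{af}+}$, then $w\to\mathrm{cl}(\nu)$ is a Bruhat (respectively quantum) edge in the parabolic quantum Bruhat graph $\mathrm{QB}(W^J)$ labeled by $w^{-1}\beta\in\Phi^+\setminus\Phi_J^+$ (respectively by $w^{-1}(\beta-\delta)$), depending on whether $\beta\in\Phi^+$ (respectively $\beta\in\delta-\Phi^+$). Conversely, if $w\overset{\gamma}{\longrightarrow}wr_\gamma=w'$ is a Bruhat edge (respectively $w\overset{\gamma}{\longrightarrow}\lfloor wr_\gamma\rfloor=w'$ is a quantum edge) in $\mathrm{QB}(W^J)$ for some $\gamma\in\Phi^+\setminus\Phi_J^+$, then there exists a cover $\mu\lessdot\nu$ in $X_{\mathrm{af}}^0(\lambda)$ labeled by $w\gamma$ (respectively $\delta+w\gamma$) with $\mathrm{cl}(\nu)=w'$.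
   Context: $\Phi$ is the (irreducible) root system of a finite-dimensional simple Lie algebra, with Dynkin node set $I$, simple roots $\alpha_i$, simple coroots $\alpha_i^\vee$, positive roots $\Phi^+$, highest root $\theta$, coroot lattice $Q^\vee$, weight lattice $X$, Weyl group $W$ with length $\ell$, reflections $r_\alpha$, $\rho=\frac12\sum_{\alpha\in\Phi^+}\alpha$; $\langle\cdot,\cdot\rangle$ is the coweight–weight pairing. Fix a dominant weight $\lambda\in X$ and put $J=\{i\in I:\langle\alpha_i^\vee,\lambda\rangle=0\}$; then $W_J=\langle r_i:i\in J\rangle$ is the stabilizer of $\lambda$ in $W$. $\Phi_J^+\subseteq\Phi^+$ are the positive roots of the root system $\Phi_J$ of $W_J$, $\rho_J=\frac12\sum_{\alpha\in\Phi_J^+}\alpha$, $W^J$ is the set of minimum-length coset representatives of $W/W_J$, and $\lfloor w\rfloor\in W^J$ is the minimum-length representative of $wW_J$. The parabolic quantum Bruhat graph $\mathrm{QB}(W^J)$ is the directed graph with vertex set $W^J$ and, for $w\in W^J$ and $\alpha\in\Phi^+\setminus\Phi_J^+$, an edge $w\overset{\alpha}{\longrightarrow}\lfloor wr_\alpha\rfloor$ labeled $\alpha$ if either (Bruhat edge) $\ell(wr_\alpha)=\ell(w)+1$ (then $wr_\alpha\in W^J$), or (quantum edge) $\ell(\lfloor wr_\alpha\rfloor)=\ell(w)+1-\langle\alpha^\vee,2\rho-2\rho_J\rangle$. Level-zero weight poset. The real affine roots (untwisted type) are $\Phi^{\mathrm{af}}=\{\alpha+n\delta:\alpha\in\Phi,n\in\mathbb{Z}\}$,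 with positive ones $\Phi^{\mathrm{af}+}=\Phi^+\sqcup(\Phi+\mathbb{Z}_{>0}\delta)$. The level-zero weight lattice is $X_{\mathrm{af}}^0=X\oplus\mathbb{Z}\delta$; the affine Weyl group $W_{\mathrm{af}}=W\ltimes\{t_\tau:\tau\in Q^\vee\}$ acts on it by $wt_\tau(\eta+k\delta)=w\eta+(k-\langle\tau,\eta\rangle)\delta$ for $\eta\in X$. For $\beta=\alpha+n\delta\in\Phi^{\mathrm{af}}$ and $\mu=\eta+k\delta\in X_{\mathrm{af}}^0$ one has $\langle\beta^\vee,\mu\rangle=\langle\alpha^\vee,\eta\rangle$ and $r_\beta\mu=\mu-\langle\beta^\vee,\mu\rangle\beta$. $X_{\mathrm{af}}^0(\lambda)$ is the $W_{\mathrm{af}}$-orbit of $\lambda$, partially ordered by the transitive closure of the relations $\mu<r_\beta\mu$ whenever $\beta\in\Phi^{\mathrm{af}+}$ and $\langle\beta^\vee,\mu\rangle>0$. A cover is denoted $\lessdot$, and a cover $\mu\lessdot\nu=r_\beta\mu$ is labeled by $\beta\in\Phi^{\mathrm{af}+}$. (It is a known fact that the label of a cover always lies in $\Phi^+$ or in $\delta-\Phi^+$.) The map $\mathrm{cl}$ sends $\eta+k\delta\in X_{\mathrm{af}}^0(\lambda)$ to $\eta\in W\lambda$, and $W\lambda$ is identified with $W/W_J$ and $W^J$; thus $\mathrm{cl}(\mu)$ denotes the element $w\in W^J$ with $\mu\in w\lambda+\mathbb{Z}\delta$. *)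

theory Defs
  imports "HOL-Analysis.Analysis"
begin

section \<open>Finite root systems and Weyl groups\<close>

text \<open>
  The root system \<open>\<Phi>\<close> lives in a Euclidean space \<open>'a\<close> which it spans. Coweights are identified
  with vectors of \<open>'a\<close> through the inner product, so the coweight--weight pairing is \<open>\<bullet>\<close>. The
  Dynkin nodes are the simple roots themselves: subsets of the node set are subsets of \<open>\<Delta>\<close>.
\<close>

definition coroot :: "'a::real_inner \<Rightarrow> 'a" where
  "coroot \<alpha> = (2 / (\<alpha> \<bullet> \<alpha>)) *\<^sub>R \<alpha>"

definition root_reflection :: "'a::real_inner \<Rightarrow> 'a \<Rightarrow> 'a" where
  "root_reflection \<alpha> \<eta> = \<eta> - (coroot \<alpha> \<bullet> \<eta>) *\<^sub>R \<alpha>"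

definition root_system :: "'a::euclidean_space set \<Rightarrow> bool" where
  "root_system \<Phi> \<longleftrightarrow>
     finite \<Phi> \<and> 0 \<notin> \<Phi> \<and> span \<Phi> = UNIV \<and>
     (\<forall>\<alpha>\<in>\<Phi>. root_reflection \<alpha> ` \<Phi> = \<Phi>) \<and>
     (\<forall>\<alpha>\<in>\<Phi>. \<forall>\<beta>\<in>\<Phi>. coroot \<alpha> \<bullet> \<beta> \<in> \<int>) \<and>
     (\<forall>\<alpha>\<in>\<Phi>. \<forall>c. c *\<^sub>R \<alpha> \<in> \<Phi> \<longrightarrow> c = 1 \<or> c = - 1)"

definition irreducible_root_system :: "'a::euclidean_space set \<Rightarrow> bool" where
  "irreducible_root_system \<Phi> \<longleftrightarrow>
     root_system \<Phi> \<and>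
     (\<forall>A B. \<Phi> = A \<union> B \<and> (\<forall>a\<in>A. \<forall>b\<in>B. a \<bullet> b = 0) \<longrightarrow> A = {} \<or> B = {})"

definition simple_system :: "'a::euclidean_space set \<Rightarrow> 'a set \<Rightarrow> bool" where
  "simple_system \<Phi> \<Delta> \<longleftrightarrow>
     \<Delta> \<subseteq> \<Phi> \<and> independent \<Delta> \<and>
     (\<forall>\<alpha>\<in>\<Phi>. \<exists>c :: 'a \<Rightarrow> nat.
        \<alpha> = (\<Sum>b\<in>\<Delta>. real (c b) *\<^sub>R b) \<or> \<alpha> = - (\<Sum>b\<in>\<Delta>. real (c b) *\<^sub>R b))"

definition positive_roots :: "'a::euclidean_space set \<Rightarrow> 'a set \<Rightarrow> 'a set" where
  "positive_roots \<Phi> \<Delta> = {\<alpha> \<in> \<Phi>. \<exists>c :: 'a \<Rightarrow> nat. \<alpha> = (\<Sum>b\<in>\<Delta>. real (c b) *\<^sub>R b)}"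

definition weight_lattice :: "'a::euclidean_space set \<Rightarrow> 'a set" where
  "weight_lattice \<Phi> = {\<eta>. \<forall>\<alpha>\<in>\<Phi>. coroot \<alpha> \<bullet> \<eta> \<in> \<int>}"

definition coroot_lattice :: "'a::euclidean_space set \<Rightarrow> 'a set" where
  "coroot_lattice \<Phi> = {\<Sum>\<alpha>\<in>\<Phi>. real_of_int (c \<alpha>) *\<^sub>R coroot \<alpha> | c :: 'a \<Rightarrow> int. True}"

definition dominant :: "'a::euclidean_space set \<Rightarrow> 'a \<Rightarrow> bool" where
  "dominant \<Delta> \<Lambda> \<longleftrightarrow> (\<forall>b\<in>\<Delta>. 0 \<le> coroot b \<bullet> \<Lambda>)"

definition stabilizer_nodes :: "'a::euclidean_space set \<Rightarrow> 'a \<Rightarrow> 'a set" where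
  "stabilizer_nodes \<Delta> \<Lambda> = {b \<in> \<Delta>. coroot b \<bullet> \<Lambda> = 0}"

definition weyl_word :: "'a::euclidean_space list \<Rightarrow> 'a \<Rightarrow> 'a" where
  "weyl_word as = foldr (\<lambda>a f. root_reflection a \<circ> f) as id"

text \<open>
  \<open>weyl \<Delta>\<close> is the Weyl group \<open>W\<close>, and \<open>weyl J\<close> for \<open>J \<subseteq> \<Delta>\<close> is the parabolic subgroup \<open>W\<^sub>J\<close>;
  words suffice to describe the generated group because reflections are involutions.
\<close>

definition weyl :: "'a::euclidean_space set \<Rightarrow> ('a \<Rightarrow> 'a) set" where
  "weyl K = weyl_word ` lists K"

definition weyl_length :: "'a::euclidean_space set \<Rightarrow> ('a \<Rightarrow> 'a) \<Rightarrow> nat" where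
  "weyl_length \<Delta> w = (LEAST n. \<exists>as\<in>lists \<Delta>. length as = n \<and> weyl_word as = w)"

definition parabolic_roots :: "'a::euclidean_space set \<Rightarrow> 'a set" where
  "parabolic_roots J = {w b | w b. w \<in> weyl J \<and> b \<in> J}"

definition parabolic_positive_roots ::
    "'a::euclidean_space set \<Rightarrow> 'a set \<Rightarrow> 'a set \<Rightarrow> 'a set" where
  "parabolic_positive_roots \<Phi> \<Delta> J = parabolic_roots J \<inter> positive_roots \<Phi> \<Delta>"

definition rho :: "'a::euclidean_space set \<Rightarrow> 'a set \<Rightarrow> 'a" where
  "rho \<Phi> \<Delta> = (1/2) *\<^sub>R (\<Sum>\<alpha>\<in>positive_roots \<Phi> \<Delta>. \<alpha>)"

definition rho_parabolic :: "'a::euclidean_space set \<Rightarrow> 'a set \<Rightarrow> 'a set \<Rightarrow> 'a" where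
  "rho_parabolic \<Phi> \<Delta> J = (1/2) *\<^sub>R (\<Sum>\<alpha>\<in>parabolic_positive_roots \<Phi> \<Delta> J. \<alpha>)"

definition min_reps :: "'a::euclidean_space set \<Rightarrow> 'a set \<Rightarrow> ('a \<Rightarrow> 'a) set" where
  "min_reps \<Delta> J =
     {w \<in> weyl \<Delta>. \<forall>v\<in>weyl J. weyl_length \<Delta> w \<le> weyl_length \<Delta> (w \<circ> v)}"

definition min_rep :: "'a::euclidean_space set \<Rightarrow> 'a set \<Rightarrow> ('a \<Rightarrow> 'a) \<Rightarrow> ('a \<Rightarrow> 'a)" where
  "min_rep \<Delta> J w = (THE x. x \<in> min_reps \<Delta> J \<and> (\<exists>v\<in>weyl J. x = w \<circ> v))"


section \<open>The parabolic quantum Bruhat graph\<close>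

text \<open>
  In both predicates the arguments after \<open>\<Phi> \<Delta> J\<close> are source, label and target of the edge.
\<close>

definition bruhat_edge ::
    "'a::euclidean_space set \<Rightarrow> 'a set \<Rightarrow> 'a set \<Rightarrow> ('a \<Rightarrow> 'a) \<Rightarrow> 'a \<Rightarrow> ('a \<Rightarrow> 'a) \<Rightarrow> bool" where
  "bruhat_edge \<Phi> \<Delta> J w \<alpha> w' \<longleftrightarrow>
     w \<in> min_reps \<Delta> J \<and>
     \<alpha> \<in> positive_roots \<Phi> \<Delta> - parabolic_positive_roots \<Phi> \<Delta> J \<and>
     w' = min_rep \<Delta> J (w \<circ> root_reflection \<alpha>) \<and>
     weyl_length \<Delta> (w \<circ> root_reflection \<alpha>) = weyl_length \<Delta> w + 1"

definition quantum_edge ::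
    "'a::euclidean_space set \<Rightarrow> 'a set \<Rightarrow> 'a set \<Rightarrow> ('a \<Rightarrow> 'a) \<Rightarrow> 'a \<Rightarrow> ('a \<Rightarrow> 'a) \<Rightarrow> bool" where
  "quantum_edge \<Phi> \<Delta> J w \<alpha> w' \<longleftrightarrow>
     w \<in> min_reps \<Delta> J \<and>
     \<alpha> \<in> positive_roots \<Phi> \<Delta> - parabolic_positive_roots \<Phi> \<Delta> J \<and>
     w' = min_rep \<Delta> J (w \<circ> root_reflection \<alpha>) \<and>
     real (weyl_length \<Delta> (min_rep \<Delta> J (w \<circ> root_reflection \<alpha>))) =
       real (weyl_length \<Delta> w) + 1
         - coroot \<alpha> \<bullet> (2 *\<^sub>R rho \<Phi> \<Delta> - 2 *\<^sub>R rho_parabolic \<Phi> \<Delta> J)"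


section \<open>The level-zero weight poset\<close>

text \<open>
  The vector \<open>\<eta> + k \<delta>\<close> is the pair \<open>(\<eta>, k)\<close>. Coefficients of \<open>\<delta>\<close> are real numbers so that the
  ambient space is a real vector space; they are integral on all the sets below.
\<close>

definition \<delta> :: "'a::euclidean_space \<times> real" where
  "\<delta> = (0, 1)"

definition of_finite :: "'a::euclidean_space \<Rightarrow> 'a \<times> real" where
  "of_finite \<alpha> = (\<alpha>, 0)"

definition affine_positive_roots ::
    "'a::euclidean_space set \<Rightarrow> 'a set \<Rightarrow> ('a \<times> real) set" where
  "affine_positive_roots \<Phi> \<Delta> =
     of_finite ` positive_roots \<Phi> \<Delta> \<union>
     {of_finite \<alpha> + real_of_int n *\<^sub>R \<delta> | \<alpha> n. \<alpha> \<in> \<Phi> \<and> n > 0}"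

definition affine_pairing :: "'a::euclidean_space \<times> real \<Rightarrow> 'a \<times> real \<Rightarrow> real" where
  "affine_pairing \<beta> \<mu> = coroot (fst \<beta>) \<bullet> fst \<mu>"

definition affine_reflection ::
    "'a::euclidean_space \<times> real \<Rightarrow> 'a \<times> real \<Rightarrow> 'a \<times> real" where
  "affine_reflection \<beta> \<mu> = \<mu> - affine_pairing \<beta> \<mu> *\<^sub>R \<beta>"

definition affine_weyl ::
    "'a::euclidean_space set \<Rightarrow> 'a set \<Rightarrow> ('a \<times> real \<Rightarrow> 'a \<times> real) set" where
  "affine_weyl \<Phi> \<Delta> =
     {\<lambda>(\<eta>, k). (w \<eta>, k - \<tau> \<bullet> \<eta>) | w \<tau>. w \<in> weyl \<Delta> \<and> \<tau> \<in> coroot_lattice \<Phi>}"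

definition level_zero_orbit ::
    "'a::euclidean_space set \<Rightarrow> 'a set \<Rightarrow> 'a \<Rightarrow> ('a \<times> real) set" where
  "level_zero_orbit \<Phi> \<Delta> \<Lambda> = {g (of_finite \<Lambda>) | g. g \<in> affine_weyl \<Phi> \<Delta>}"

definition level_zero_step ::
    "'a::euclidean_space set \<Rightarrow> 'a set \<Rightarrow> 'a \<Rightarrow> 'a \<times> real \<Rightarrow> 'a \<times> real \<Rightarrow> bool" where
  "level_zero_step \<Phi> \<Delta> \<Lambda> \<mu> \<nu> \<longleftrightarrow>
     \<mu> \<in> level_zero_orbit \<Phi> \<Delta> \<Lambda> \<and>
     (\<exists>\<beta>\<in>affine_positive_roots \<Phi> \<Delta>. affine_pairing \<beta> \<mu> > 0 \<and> \<nu> = affine_reflection \<beta> \<mu>)"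

definition level_zero_less ::
    "'a::euclidean_space set \<Rightarrow> 'a set \<Rightarrow> 'a \<Rightarrow> 'a \<times> real \<Rightarrow> 'a \<times> real \<Rightarrow> bool" where
  "level_zero_less \<Phi> \<Delta> \<Lambda> = (level_zero_step \<Phi> \<Delta> \<Lambda>)\<^sup>+\<^sup>+"

definition level_zero_covers ::
    "'a::euclidean_space set \<Rightarrow> 'a set \<Rightarrow> 'a \<Rightarrow> 'a \<times> real \<Rightarrow> 'a \<times> real \<Rightarrow> bool" where
  "level_zero_covers \<Phi> \<Delta> \<Lambda> \<mu> \<nu> \<longleftrightarrow>
     level_zero_less \<Phi> \<Delta> \<Lambda> \<mu> \<nu> \<and>
     \<not> (\<exists>\<kappa>. level_zero_less \<Phi> \<Delta> \<Lambda> \<mu> \<kappa> \<and> level_zero_less \<Phi> \<Delta> \<Lambda> \<kappa> \<nu>)"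

text \<open>\<open>labeled_cover \<Phi> \<Delta> \<Lambda> \<mu> \<beta> \<nu>\<close>: the element \<open>\<nu>\<close> covers \<open>\<mu>\<close>, with label \<open>\<beta>\<close>.\<close>

definition labeled_cover ::
    "'a::euclidean_space set \<Rightarrow> 'a set \<Rightarrow> 'a \<Rightarrow> 'a \<times> real \<Rightarrow> 'a \<times> real \<Rightarrow> 'a \<times> real \<Rightarrow> bool" where
  "labeled_cover \<Phi> \<Delta> \<Lambda> \<mu> \<beta> \<nu> \<longleftrightarrow>
     level_zero_covers \<Phi> \<Delta> \<Lambda> \<mu> \<nu> \<and>
     \<beta> \<in> affine_positive_roots \<Phi> \<Delta> \<and> \<nu> = affine_reflection \<beta> \<mu>"

definition cl ::
    "'a::euclidean_space set \<Rightarrow> 'a \<Rightarrow> 'a \<times> real \<Rightarrow> ('a \<Rightarrow> 'a)" where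
  "cl \<Delta> \<Lambda> \<mu> =
     (THE w. w \<in> min_reps \<Delta> (stabilizer_nodes \<Delta> \<Lambda>) \<and>
        (\<exists>k. \<mu> = of_finite (w \<Lambda>) + real_of_int k *\<^sub>R \<delta>))"

end

theory Submission imports Defs begin

text \<open>
  Write \<open>\<eta>\<close> for the finite part of a level-zero weight \<open>\<mu> = w t\<^sub>\<tau> \<Lambda>\<close>, with \<open>w\<close> a minimal coset
  representative. The semi-infinite length \<open>\<ell>(w) + \<langle>\<tau>, 2 \<rho> - 2 \<rho>\<^sub>J\<rangle>\<close> need not be a function of \<open>\<mu>\<close>,
  because \<open>\<tau>\<close> is determined only up to elements orthogonal to \<open>\<Lambda>\<close>; but its change along a
  single step \<open>\<mu> \<mapsto> r\<^sub>\<beta> \<mu>\<close> with \<open>\<beta> = \<alpha> + n \<delta>\<close> is determined by \<open>\<eta>\<close> and \<open>\<beta>\<close>. It equals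
  \<open>length_gain\<close>, namely \<open>inversions (r\<^sub>\<alpha> \<eta>) - inversions \<eta> + n \<langle>\<alpha>\<^sup>\<or>, positive_sum \<eta>\<rangle>\<close>, where
  \<open>inversions \<eta>\<close> counts the positive roots that are negative on \<open>\<eta>\<close>, which gives \<open>\<ell>(w)\<close>, and
  \<open>positive_sum \<eta>\<close> is the sum of all roots that are positive on \<open>\<eta>\<close>, which gives
  \<open>w (2 \<rho> - 2 \<rho>\<^sub>J)\<close>. With \<open>n = 0\<close> and \<open>n = 1\<close>, a gain of one says exactly that the step lies over a
  Bruhat edge, respectively a quantum edge.

  The heart of the proof is \<open>covers_iff_length_gain\<close>: every step gains at least one, and it is a
  cover if and only if it gains exactly one. Both claims are proved at once by induction on the height
  of the label \<open>\<beta>\<close>. For an affine simple root \<open>b\<close>, the reflection in \<open>b\<close> keeps positive every positive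
  affine root except \<open>b\<close>, and it changes the semi-infinite length by the sign of the pairing with
  \<open>b\<close> (\<open>length_gain_simple\<close>). Choosing \<open>b\<close> at an acute angle with \<open>\<beta>\<close> makes the
  pairing of \<open>b\<close> drop strictly from \<open>\<mu>\<close> to \<open>\<nu>\<close>. If the two pairings are nonzero of equal sign,
  then reflecting both ends in \<open>b\<close> preserves the gain (\<open>length_gain_conjugate\<close>) and, by the
  lifting property, also whether the step is a cover (\<open>covers_reflect_iff\<close>), and the label becomes
  lower. Otherwise the step factors visibly and its gain exceeds one. The induction ends at the affine
  simple labels, whose steps gain one and are covers because affine simple roots are indecomposable
  (\<open>covers_simple\<close>).

  Raising \<open>n\<close> by one raises the gain by \<open>\<langle>\<alpha>\<^sup>\<or>, positive_sum \<eta>\<rangle> > 0\<close>. Since the smallest admissible \<open>n\<close>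
  already gains at least one, covers only occur for that \<open>n\<close>, which is \<open>0\<close> for positive \<open>\<alpha>\<close> and \<open>1\<close>
  for negative \<open>\<alpha>\<close> (\<open>cover_label_level\<close>).

  The dictionary with the parabolic quantum Bruhat graph needs the usual facts on Weyl groups, derived
  from the exchange condition. One point is special to the parabolic case: for a Bruhat
  edge the length of \<open>w r\<^sub>\<gamma>\<close> itself has to be known, and not just that of its minimal
  representative (\<open>min_rep_reflection_length\<close>). The affine simple root \<open>\<delta> - \<theta>\<close> comes from the highest
  root \<open>\<theta>\<close>, whose existence is where irreducibility enters (\<open>exists_highest_root\<close>).
\<close>

section \<open>Reflections\<close>

lemma coroot_inner: "coroot \<alpha> \<bullet> x = 2 * (\<alpha> \<bullet> x) / (\<alpha> \<bullet> \<alpha>)"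
  by (simp add: coroot_def)

lemma coroot_minus: "coroot (- \<alpha>) = - coroot \<alpha>"
  by (simp add: coroot_def)

lemma sgn_coroot_inner:
  assumes "\<alpha> \<noteq> 0"
  shows "sgn (coroot \<alpha> \<bullet> x) = sgn (\<alpha> \<bullet> x)"
  using assms by (simp add: coroot_inner sgn_mult sgn_divide)

lemma coroot_inner_pos_iff:
  assumes "\<alpha> \<noteq> 0"
  shows "coroot \<alpha> \<bullet> x > 0 \<longleftrightarrow> \<alpha> \<bullet> x > 0" "coroot \<alpha> \<bullet> x < 0 \<longleftrightarrow> \<alpha> \<bullet> x < 0"
    "coroot \<alpha> \<bullet> x = 0 \<longleftrightarrow> \<alpha> \<bullet> x = 0"
  using sgn_coroot_inner[OF assms, of x] by (metis sgn_greater, metis sgn_less, metis sgn_zero_iff)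

lemma root_reflection_self: "root_reflection \<alpha> \<alpha> = - \<alpha>"
  by (cases "\<alpha> = 0") (simp_all add: root_reflection_def coroot_inner scaleR_2)

lemma root_reflection_uminus: "root_reflection (- \<alpha>) = root_reflection \<alpha>"
  by (simp add: fun_eq_iff root_reflection_def coroot_minus)

lemma inner_root_reflection:
  "x \<bullet> root_reflection \<alpha> y = x \<bullet> y - (coroot \<alpha> \<bullet> y) * (x \<bullet> \<alpha>)"
  by (simp add: root_reflection_def inner_diff_right)

lemma root_reflection_swap: "root_reflection \<alpha> x \<bullet> y = x \<bullet> root_reflection \<alpha> y"
  by (simp add: root_reflection_def inner_diff_right inner_diff_left coroot_def inner_commute)

lemma root_reflection_involution [simp]: "root_reflection \<alpha> (root_reflection \<alpha> x) = x"
  by (cases "\<alpha> = 0")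
     (simp_all add: root_reflection_def inner_diff_right coroot_inner algebra_simps scaleR_left_distrib[symmetric])

lemma orthogonal_root_reflection: "orthogonal_transformation (root_reflection \<alpha>)"
proof -
  have "linear (root_reflection \<alpha>)"
    by (rule linearI) (simp_all add: root_reflection_def inner_add_right algebra_simps)
  then show ?thesis
    by (simp add: orthogonal_transformation_def root_reflection_swap)
qed

lemma orthogonal_coroot:
  assumes "orthogonal_transformation g"
  shows "coroot (g \<alpha>) = g (coroot \<alpha>)"
  using assms by (simp add: coroot_def orthogonal_transformation_def linear_cmul)

lemma orthogonal_conjugates_reflection:
  assumes "orthogonal_transformation g"
  shows "g (root_reflection \<alpha> x) = root_reflection (g \<alpha>) (g x)"
  using assms
  by (simp add: root_reflection_def orthogonal_coroot)
     (simp add: orthogonal_transformation_def linear_cmul linear_diff)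


section \<open>Positive roots\<close>

locale based_root_system =
  fixes \<Phi> \<Delta> :: "'a::euclidean_space set"
  assumes root_system: "root_system \<Phi>" and simple_system: "simple_system \<Phi> \<Delta>"
begin

abbreviation "\<Phi>p \<equiv> positive_roots \<Phi> \<Delta>"

lemma finite_roots: "finite \<Phi>"
  and root_nonzero: "\<alpha> \<in> \<Phi> \<Longrightarrow> \<alpha> \<noteq> 0"
  and roots_span: "span \<Phi> = UNIV"
  and reflection_roots: "\<alpha> \<in> \<Phi> \<Longrightarrow> root_reflection \<alpha> ` \<Phi> = \<Phi>"
  and coroot_integral: "\<alpha> \<in> \<Phi> \<Longrightarrow> \<beta> \<in> \<Phi> \<Longrightarrow> coroot \<alpha> \<bullet> \<beta> \<in> \<int>"
  and root_multiple: "\<alpha> \<in> \<Phi> \<Longrightarrow> c *\<^sub>R \<alpha> \<in> \<Phi> \<Longrightarrow> c = 1 \<or> c = - 1"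
  using root_system unfolding root_system_def by auto

lemma simple_is_root: "b \<in> \<Delta> \<Longrightarrow> b \<in> \<Phi>"
  and simple_independent: "independent \<Delta>"
  and root_sign: "\<alpha> \<in> \<Phi> \<Longrightarrow> \<exists>c :: 'a \<Rightarrow> nat.
        \<alpha> = (\<Sum>b\<in>\<Delta>. real (c b) *\<^sub>R b) \<or> \<alpha> = - (\<Sum>b\<in>\<Delta>. real (c b) *\<^sub>R b)"
  using simple_system unfolding simple_system_def by auto

lemma finite_simple: "finite \<Delta>"
  by (rule finite_subset[OF _ finite_roots]) (auto simp: simple_is_root)

lemma reflection_root: "\<alpha> \<in> \<Phi> \<Longrightarrow> \<beta> \<in> \<Phi> \<Longrightarrow> root_reflection \<alpha> \<beta> \<in> \<Phi>"
  using reflection_roots by blast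

lemma minus_root: "\<alpha> \<in> \<Phi> \<Longrightarrow> - \<alpha> \<in> \<Phi>"
  using reflection_root[of \<alpha> \<alpha>] by (simp add: root_reflection_self)

lemma positive_is_root: "\<alpha> \<in> \<Phi>p \<Longrightarrow> \<alpha> \<in> \<Phi>"
  by (simp add: positive_roots_def)

lemma finite_positive: "finite \<Phi>p"
  by (rule finite_subset[OF _ finite_roots]) (auto simp: positive_is_root)

text \<open>The fundamental coweights, that is, the basis dual to the simple roots.\<close>

definition coweight :: "'a \<Rightarrow> 'a" where
  "coweight b = (SOME v. \<forall>a\<in>\<Delta>. v \<bullet> a = (if a = b then 1 else 0))"

lemma coweight_simple:
  assumes "a \<in> \<Delta>"
  shows "coweight b \<bullet> a = (if a = b then 1 else 0)"
proof -
  obtain g :: "'a \<Rightarrow> real" where g: "linear g" "\<forall>x\<in>\<Delta>. g x = (if x = b then 1 else 0)"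
    using linear_independent_extend[OF simple_independent, where f = "\<lambda>x. if x = b then 1 else 0"]
    by metis
  have "adjoint g 1 \<bullet> x = g x" for x
    using adjoint_works[OF g(1), of x 1] by (metis inner_commute inner_real_def mult_1)
  then have "\<forall>a\<in>\<Delta>. adjoint g 1 \<bullet> a = (if a = b then 1 else 0)"
    using g(2) by simp
  then have "\<forall>a\<in>\<Delta>. coweight b \<bullet> a = (if a = b then 1 else 0)"
    unfolding coweight_def by (rule someI)
  then show ?thesis
    using assms by simp
qed

lemma coweight_sum:
  assumes "b \<in> \<Delta>"
  shows "coweight b \<bullet> (\<Sum>a\<in>\<Delta>. c a *\<^sub>R a) = c b"
proof -
  have "coweight b \<bullet> (\<Sum>a\<in>\<Delta>. c a *\<^sub>R a) = (\<Sum>a\<in>\<Delta>. if a = b then c b else 0)"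
    unfolding inner_sum_right by (rule sum.cong) (auto simp: coweight_simple)
  then show ?thesis
    using assms by (simp add: finite_simple)
qed

lemma simple_expansion: "x = (\<Sum>b\<in>\<Delta>. (coweight b \<bullet> x) *\<^sub>R b)"
proof -
  have "\<Phi> \<subseteq> span \<Delta>"
  proof
    fix \<alpha> assume "\<alpha> \<in> \<Phi>"
    then obtain c :: "'a \<Rightarrow> nat" where
      "\<alpha> = (\<Sum>b\<in>\<Delta>. real (c b) *\<^sub>R b) \<or> \<alpha> = - (\<Sum>b\<in>\<Delta>. real (c b) *\<^sub>R b)"
      using root_sign by blast
    moreover have "(\<Sum>b\<in>\<Delta>. real (c b) *\<^sub>R b) \<in> span \<Delta>"
      by (intro span_sum span_scale span_base)
    ultimately show "\<alpha> \<in> span \<Delta>"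
      by (auto simp: span_neg)
  qed
  then have "span \<Delta> = UNIV"
    using roots_span span_mono[of \<Phi> "span \<Delta>"] by (simp add: span_span top.extremum_unique)
  then obtain u where "x = (\<Sum>b\<in>\<Delta>. u b *\<^sub>R b)"
    using span_finite[OF finite_simple] by blast
  then show ?thesis
    by (simp add: coweight_sum)
qed

lemma inner_simple_expansion: "x \<bullet> y = (\<Sum>b\<in>\<Delta>. (coweight b \<bullet> x) * (b \<bullet> y))"
  by (subst simple_expansion[of x]) (simp add: inner_sum_left)

lemma eq_zero_if_coweights_zero: "(\<And>b. b \<in> \<Delta> \<Longrightarrow> coweight b \<bullet> x = 0) \<Longrightarrow> x = 0"
  by (subst simple_expansion) simp

lemma positive_iff: "\<alpha> \<in> \<Phi>p \<longleftrightarrow> \<alpha> \<in> \<Phi> \<and> (\<forall>b\<in>\<Delta>. coweight b \<bullet> \<alpha> \<ge> 0)"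
proof
  assume "\<alpha> \<in> \<Phi>p"
  then show "\<alpha> \<in> \<Phi> \<and> (\<forall>b\<in>\<Delta>. coweight b \<bullet> \<alpha> \<ge> 0)"
    by (auto simp: positive_roots_def coweight_sum)
next
  assume *: "\<alpha> \<in> \<Phi> \<and> (\<forall>b\<in>\<Delta>. coweight b \<bullet> \<alpha> \<ge> 0)"
  then obtain c :: "'a \<Rightarrow> nat" where
    c: "\<alpha> = (\<Sum>b\<in>\<Delta>. real (c b) *\<^sub>R b) \<or> \<alpha> = - (\<Sum>b\<in>\<Delta>. real (c b) *\<^sub>R b)"
    using root_sign by blast
  then show "\<alpha> \<in> \<Phi>p"
  proof
    assume "\<alpha> = (\<Sum>b\<in>\<Delta>. real (c b) *\<^sub>R b)"
    then show ?thesis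
      using * unfolding positive_roots_def by blast
  next
    assume eq: "\<alpha> = - (\<Sum>b\<in>\<Delta>. real (c b) *\<^sub>R b)"
    have "coweight b \<bullet> \<alpha> = 0" if "b \<in> \<Delta>" for b
      using * that coweight_sum[OF that, of "\<lambda>b. real (c b)"] by (auto simp: eq)
    then show ?thesis
      using * eq_zero_if_coweights_zero root_nonzero by blast
  qed
qed

lemma positive_or_negative: "\<alpha> \<in> \<Phi> \<Longrightarrow> \<alpha> \<in> \<Phi>p \<or> - \<alpha> \<in> \<Phi>p"
  using root_sign[of \<alpha>] minus_root[of \<alpha>] unfolding positive_roots_def by fastforce

lemma simple_positive: "b \<in> \<Delta> \<Longrightarrow> b \<in> \<Phi>p"
  by (simp add: positive_iff simple_is_root coweight_simple)

text \<open>The half-sum of the positive coroots, encoded as the sum of the fundamental coweights: its inner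
  product with a root is the height of the root.\<close>

definition rho_check :: 'a where
  "rho_check = (\<Sum>b\<in>\<Delta>. coweight b)"

lemma rho_check_inner: "rho_check \<bullet> x = (\<Sum>b\<in>\<Delta>. coweight b \<bullet> x)"
  by (simp add: rho_check_def inner_sum_left)

lemma rho_check_simple: "b \<in> \<Delta> \<Longrightarrow> rho_check \<bullet> b = 1"
  by (simp add: rho_check_inner coweight_simple finite_simple)

lemma rho_check_zero_iff:
  assumes "\<And>b. b \<in> \<Delta> \<Longrightarrow> coweight b \<bullet> x \<ge> 0"
  shows "rho_check \<bullet> x = 0 \<longleftrightarrow> x = 0"
proof
  assume "rho_check \<bullet> x = 0"
  then have "coweight b \<bullet> x = 0" if "b \<in> \<Delta>" for b
    using that assms sum_nonneg_eq_0_iff[OF finite_simple, of "\<lambda>b. coweight b \<bullet> x"]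
    by (simp add: rho_check_inner)
  then show "x = 0"
    by (rule eq_zero_if_coweights_zero)
qed simp

lemma rho_check_positive: "\<alpha> \<in> \<Phi>p \<Longrightarrow> rho_check \<bullet> \<alpha> > 0"
  using rho_check_zero_iff[of \<alpha>] root_nonzero[of \<alpha>]
  by (auto simp: positive_iff rho_check_inner sum_nonneg less_le)

lemma positive_iff_height: "\<alpha> \<in> \<Phi>p \<longleftrightarrow> \<alpha> \<in> \<Phi> \<and> rho_check \<bullet> \<alpha> > 0"
  using rho_check_positive[of \<alpha>] rho_check_positive[of "- \<alpha>"] positive_or_negative[of \<alpha>]
    positive_is_root[of \<alpha>] by auto

lemma rho_check_regular: "\<alpha> \<in> \<Phi> \<Longrightarrow> \<alpha> \<bullet> rho_check \<noteq> 0"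
  using rho_check_positive[of \<alpha>] rho_check_positive[of "- \<alpha>"] positive_or_negative[of \<alpha>]
  by (auto simp: inner_commute)

lemma height_integral:
  assumes "\<alpha> \<in> \<Phi>"
  shows "rho_check \<bullet> \<alpha> \<in> \<int>"
proof -
  obtain c :: "'a \<Rightarrow> nat" where
    "\<alpha> = (\<Sum>b\<in>\<Delta>. real (c b) *\<^sub>R b) \<or> \<alpha> = - (\<Sum>b\<in>\<Delta>. real (c b) *\<^sub>R b)"
    using root_sign[OF assms] by blast
  then show ?thesis
    by (auto simp: inner_sum_right rho_check_simple intro!: Ints_sum)
qed

lemma not_positive_and_negative: "\<alpha> \<in> \<Phi>p \<Longrightarrow> - \<alpha> \<notin> \<Phi>p"
  using rho_check_positive[of \<alpha>] rho_check_positive[of "- \<alpha>"] by auto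

lemma sum_roots_via_positive:
  fixes f :: "'a \<Rightarrow> 'b::comm_monoid_add"
  shows "sum f \<Phi> = (\<Sum>\<beta>\<in>\<Phi>p. f \<beta> + f (- \<beta>))"
proof -
  have eq: "\<Phi> = \<Phi>p \<union> uminus ` \<Phi>p"
    using positive_or_negative positive_is_root minus_root by (auto simp: image_iff) (metis minus_minus)
  have "sum f \<Phi> = sum f \<Phi>p + sum f (uminus ` \<Phi>p)"
    by (subst eq, rule sum.union_disjoint)
       (use finite_positive not_positive_and_negative in auto)
  then show ?thesis
    by (simp add: sum.reindex sum.distrib)
qed

text \<open>A positive root other than \<open>a\<close> involves a second simple root, whose coefficient
  the reflection in \<open>a\<close> does not touch.\<close>

lemma simple_reflection_positive:
  assumes "a \<in> \<Delta>" "\<alpha> \<in> \<Phi>p" "\<alpha> \<noteq> a"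
  shows "root_reflection a \<alpha> \<in> \<Phi>p"
proof -
  have root: "root_reflection a \<alpha> \<in> \<Phi>"
    using assms reflection_root simple_is_root positive_is_root by blast
  have coeff: "coweight b \<bullet> root_reflection a \<alpha> = coweight b \<bullet> \<alpha>" if "b \<in> \<Delta>" "b \<noteq> a" for b
    using that assms(1) by (simp add: inner_root_reflection coweight_simple)
  have "\<exists>b\<in>\<Delta>. b \<noteq> a \<and> coweight b \<bullet> \<alpha> > 0"
  proof (rule ccontr)
    assume neg: "\<not> ?thesis"
    have "\<alpha> = (\<Sum>b\<in>\<Delta>. (coweight b \<bullet> \<alpha>) *\<^sub>R b)"
      by (rule simple_expansion)
    also have "\<dots> = (\<Sum>b\<in>\<Delta>. if b = a then (coweight a \<bullet> \<alpha>) *\<^sub>R a else 0)"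
      by (rule sum.cong) (use neg assms(2) positive_iff in \<open>force+\<close>)
    also have "\<dots> = (coweight a \<bullet> \<alpha>) *\<^sub>R a"
      using assms(1) finite_simple by simp
    finally have eq: "\<alpha> = (coweight a \<bullet> \<alpha>) *\<^sub>R a" .
    moreover have "coweight a \<bullet> \<alpha> \<ge> 0"
      using assms positive_iff by blast
    ultimately have "coweight a \<bullet> \<alpha> = 1"
      using root_multiple[of a "coweight a \<bullet> \<alpha>"] assms simple_is_root positive_is_root by force
    then show False
      using eq assms(3) by simp
  qed
  then obtain b where b: "b \<in> \<Delta>" "b \<noteq> a" "coweight b \<bullet> \<alpha> > 0"
    by blast
  show ?thesis
  proof (rule ccontr)
    assume "\<not> ?thesis"
    then have "- root_reflection a \<alpha> \<in> \<Phi>p"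
      using root positive_or_negative by blast
    then have "coweight b \<bullet> (- root_reflection a \<alpha>) \<ge> 0"
      using b(1) positive_iff by blast
    then show False
      using b coeff by simp
  qed
qed

lemma positive_root_meets_simple:
  assumes "\<alpha> \<in> \<Phi>p"
  obtains a where "a \<in> \<Delta>" "coweight a \<bullet> \<alpha> > 0" "a \<bullet> \<alpha> > 0"
proof -
  have "(\<Sum>b\<in>\<Delta>. (coweight b \<bullet> \<alpha>) * (b \<bullet> \<alpha>)) > 0"
    using assms root_nonzero positive_is_root inner_simple_expansion[of \<alpha> \<alpha>]
    by (metis inner_gt_zero_iff)
  then obtain a where "a \<in> \<Delta>" "(coweight a \<bullet> \<alpha>) * (a \<bullet> \<alpha>) > 0"
    by (meson leD not_less sum_nonpos)
  moreover have "coweight a \<bullet> \<alpha> \<ge> 0"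
    using \<open>a \<in> \<Delta>\<close> assms positive_iff by blast
  ultimately show ?thesis
    using that by (simp add: zero_less_mult_iff)
qed

lemma simple_roots_obtuse:
  assumes "a \<in> \<Delta>" "b \<in> \<Delta>" "a \<noteq> b"
  shows "a \<bullet> b \<le> 0"
proof (rule ccontr)
  assume "\<not> ?thesis"
  then have pos: "coroot a \<bullet> b > 0"
    using coroot_inner_pos_iff(1)[OF root_nonzero, OF simple_is_root, OF assms(1)] by simp
  have "root_reflection a b \<in> \<Phi>p"
    using assms simple_reflection_positive simple_positive by blast
  then have "coweight a \<bullet> root_reflection a b \<ge> 0"
    using assms positive_iff by blast
  then show False
    using pos assms by (simp add: inner_root_reflection coweight_simple)
qed

text \<open>Induction on the height: a positive root that is not simple becomes lower, and stays
  positive, under the reflection in some simple root of its support.\<close>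

lemma positive_root_induct [consumes 1, case_names simple reflect]:
  assumes "\<alpha> \<in> \<Phi>p"
    and simple: "\<And>a. a \<in> \<Delta> \<Longrightarrow> P a"
    and reflect: "\<And>\<alpha> a. \<alpha> \<in> \<Phi>p \<Longrightarrow> a \<in> \<Delta> \<Longrightarrow> \<alpha> \<noteq> a \<Longrightarrow> coweight a \<bullet> \<alpha> > 0 \<Longrightarrow> a \<bullet> \<alpha> > 0
       \<Longrightarrow> root_reflection a \<alpha> \<in> \<Phi>p \<Longrightarrow> P (root_reflection a \<alpha>) \<Longrightarrow> P \<alpha>"
  shows "P \<alpha>"
  using assms(1)
proof (induction "nat \<lfloor>rho_check \<bullet> \<alpha>\<rfloor>" arbitrary: \<alpha> rule: less_induct)
  case less
  obtain a where a: "a \<in> \<Delta>" "coweight a \<bullet> \<alpha> > 0" "a \<bullet> \<alpha> > 0"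
    using less.prems by (rule positive_root_meets_simple)
  show ?case
  proof (cases "\<alpha> = a")
    case True
    then show ?thesis
      using a simple by simp
  next
    case False
    have pos: "root_reflection a \<alpha> \<in> \<Phi>p"
      using simple_reflection_positive a less.prems False by blast
    have "coroot a \<bullet> \<alpha> > 0"
      using a coroot_inner_pos_iff(1)[OF root_nonzero, OF simple_is_root, of a] by simp
    then have "rho_check \<bullet> root_reflection a \<alpha> < rho_check \<bullet> \<alpha>"
      using a by (simp add: inner_root_reflection rho_check_simple)
    moreover have "rho_check \<bullet> root_reflection a \<alpha> \<in> \<int>" "rho_check \<bullet> \<alpha> \<in> \<int>"
      using pos less.prems height_integral positive_is_root by auto
    ultimately have "nat \<lfloor>rho_check \<bullet> root_reflection a \<alpha>\<rfloor> < nat \<lfloor>rho_check \<bullet> \<alpha>\<rfloor>"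
      using rho_check_positive[OF pos] by (elim Ints_cases) simp
    then show ?thesis
      using less.hyps pos reflect[OF less.prems a(1) False a(2,3) pos] by blast
  qed
qed


section \<open>The highest root\<close>

text \<open>The order on weights compares coefficients with respect to the simple roots; these are the inner
  products with the fundamental coweights.\<close>

definition highest :: "'a \<Rightarrow> bool" where
  "highest \<theta> \<longleftrightarrow> \<theta> \<in> \<Phi> \<and> (\<forall>\<beta>\<in>\<Phi>. \<forall>b\<in>\<Delta>. coweight b \<bullet> \<beta> \<le> coweight b \<bullet> \<theta>)"

definition maximal_root :: "'a \<Rightarrow> bool" where
  "maximal_root \<gamma> \<longleftrightarrow> \<gamma> \<in> \<Phi> \<and>
     (\<forall>\<beta>\<in>\<Phi>. (\<forall>b\<in>\<Delta>. coweight b \<bullet> \<gamma> \<le> coweight b \<bullet> \<beta>) \<longrightarrow> \<beta> = \<gamma>)"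

lemma below_maximal_root:
  assumes "\<beta> \<in> \<Phi>"
  obtains \<gamma> where "maximal_root \<gamma>" "\<And>b. b \<in> \<Delta> \<Longrightarrow> coweight b \<bullet> \<beta> \<le> coweight b \<bullet> \<gamma>"
proof -
  define A where "A = {\<gamma> \<in> \<Phi>. \<forall>b\<in>\<Delta>. coweight b \<bullet> \<beta> \<le> coweight b \<bullet> \<gamma>}"
  have "finite A" "A \<noteq> {}"
    using finite_roots assms by (auto simp: A_def)
  then obtain \<gamma> where \<gamma>: "\<gamma> \<in> A" "\<And>\<gamma>'. \<gamma>' \<in> A \<Longrightarrow> rho_check \<bullet> \<gamma>' \<le> rho_check \<bullet> \<gamma>"
    using obtains_MAX[of A "\<lambda>x. rho_check \<bullet> x"] by (metis Max_ge finite_imageI imageI)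
  have "\<gamma>' = \<gamma>" if "\<gamma>' \<in> \<Phi>" "\<forall>b\<in>\<Delta>. coweight b \<bullet> \<gamma> \<le> coweight b \<bullet> \<gamma>'" for \<gamma>'
  proof -
    have "\<gamma>' \<in> A"
      using that \<gamma>(1) by (force simp: A_def)
    then have "rho_check \<bullet> (\<gamma>' - \<gamma>) \<le> 0"
      using \<gamma>(2) by (simp add: inner_diff_right)
    moreover have nonneg: "coweight b \<bullet> (\<gamma>' - \<gamma>) \<ge> 0" if "b \<in> \<Delta>" for b
      using that \<open>\<forall>b\<in>\<Delta>. coweight b \<bullet> \<gamma> \<le> coweight b \<bullet> \<gamma>'\<close> by (simp add: inner_diff_right)
    moreover have "rho_check \<bullet> (\<gamma>' - \<gamma>) \<ge> 0"
      unfolding rho_check_inner by (rule sum_nonneg) (rule nonneg)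
    ultimately show ?thesis
      using rho_check_zero_iff[of "\<gamma>' - \<gamma>"] by auto
  qed
  then have "maximal_root \<gamma>"
    using \<gamma>(1) by (simp add: maximal_root_def A_def)
  with \<gamma>(1) show ?thesis
    by (intro that) (auto simp: A_def)
qed

lemma maximal_root_dominant:
  assumes "maximal_root \<gamma>" "a \<in> \<Delta>"
  shows "a \<bullet> \<gamma> \<ge> 0"
proof (rule ccontr)
  assume "\<not> ?thesis"
  then have neg: "coroot a \<bullet> \<gamma> < 0"
    using coroot_inner_pos_iff(2)[OF root_nonzero, OF simple_is_root, OF assms(2)] by simp
  have "root_reflection a \<gamma> \<in> \<Phi>"
    using assms reflection_root simple_is_root by (auto simp: maximal_root_def)
  moreover have "\<forall>b\<in>\<Delta>. coweight b \<bullet> \<gamma> \<le> coweight b \<bullet> root_reflection a \<gamma>"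
    using neg assms(2) by (auto simp: inner_root_reflection coweight_simple)
  ultimately have "root_reflection a \<gamma> = \<gamma>"
    using assms(1) by (auto simp: maximal_root_def)
  then have "(coroot a \<bullet> \<gamma>) *\<^sub>R a = 0"
    by (simp add: root_reflection_def)
  then show False
    using neg root_nonzero simple_is_root assms(2) by auto
qed

lemma maximal_root_positive:
  assumes "maximal_root \<gamma>"
  shows "\<gamma> \<in> \<Phi>p"
proof (rule ccontr)
  assume "\<not> ?thesis"
  then have neg: "- \<gamma> \<in> \<Phi>p"
    using assms positive_or_negative by (auto simp: maximal_root_def)
  then have "\<forall>b\<in>\<Delta>. coweight b \<bullet> (- \<gamma>) \<ge> 0"
    using positive_iff by blast
  then have "\<forall>b\<in>\<Delta>. coweight b \<bullet> \<gamma> \<le> coweight b \<bullet> (- \<gamma>)"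
    by (metis inner_minus_right neg_0_le_iff_le order_trans)
  then have "- \<gamma> = \<gamma>"
    using assms positive_is_root[OF neg] unfolding maximal_root_def by blast
  then have "rho_check \<bullet> \<gamma> = - (rho_check \<bullet> \<gamma>)"
    by (metis inner_minus_right)
  then show False
    using rho_check_positive[OF neg] by simp
qed

text \<open>A partition of the simple roots into orthogonal parts propagates to all roots, by
  induction on the height.\<close>

lemma irreducible_simple:
  assumes irred: "irreducible_root_system \<Phi>"
    and S: "S \<subseteq> \<Delta>" "S \<noteq> {}"
    and orth: "\<And>a b. a \<in> S \<Longrightarrow> b \<in> \<Delta> - S \<Longrightarrow> a \<bullet> b = 0"
  shows "S = \<Delta>"
proof (rule ccontr)
  assume "S \<noteq> \<Delta>"
  define A where "A = \<Phi> \<inter> span S"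
  define B where "B = \<Phi> \<inter> span (\<Delta> - S)"
  have orth': "x \<bullet> y = 0" if "x \<in> span S" "y \<in> span (\<Delta> - S)" for x y
  proof -
    have "b \<bullet> x = 0" if "b \<in> \<Delta> - S" for b
      by (rule orthogonal_to_span[OF \<open>x \<in> span S\<close>, unfolded orthogonal_def])
         (use that orth in \<open>auto simp: inner_commute\<close>)
    then show ?thesis
      by (intro orthogonal_to_span[OF that(2), unfolded orthogonal_def]) (simp add: inner_commute)
  qed
  have "\<alpha> \<in> span S \<or> \<alpha> \<in> span (\<Delta> - S)" if "\<alpha> \<in> \<Phi>p" for \<alpha>
    using that
  proof (induction rule: positive_root_induct)
    case (simple a)
    then show ?case
      by (auto intro: span_base)
  next
    case (reflect \<alpha> a)
    have eq: "\<alpha> = root_reflection a \<alpha> + (coroot a \<bullet> \<alpha>) *\<^sub>R a"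
      by (simp add: root_reflection_def)
    have nonzero: "root_reflection a \<alpha> \<bullet> a \<noteq> 0"
      using reflect(5) root_reflection_swap[of a \<alpha> a]
      by (simp add: root_reflection_self inner_commute)
    show ?case
    proof (cases "a \<in> S")
      case True
      then have "root_reflection a \<alpha> \<in> span S"
        using reflect.IH nonzero orth'[of a "root_reflection a \<alpha>"] span_base[of a S]
        by (auto simp: inner_commute)
      then have "root_reflection a \<alpha> + (coroot a \<bullet> \<alpha>) *\<^sub>R a \<in> span S"
        using True by (simp add: span_add span_scale span_base)
      then show ?thesis
        using eq by metis
    next
      case False
      then have a: "a \<in> \<Delta> - S"
        using reflect by blast
      then have "root_reflection a \<alpha> \<in> span (\<Delta> - S)"
        using reflect.IH nonzero orth'[of "root_reflection a \<alpha>" a] span_base[of a "\<Delta> - S"]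
        by auto
      then have "root_reflection a \<alpha> + (coroot a \<bullet> \<alpha>) *\<^sub>R a \<in> span (\<Delta> - S)"
        using a by (simp add: span_add span_scale span_base)
      then show ?thesis
        using eq by metis
    qed
  qed
  then have "\<alpha> \<in> A \<union> B" if "\<alpha> \<in> \<Phi>" for \<alpha>
    using that positive_or_negative[OF that] span_neg[of "- \<alpha>"] unfolding A_def B_def by fastforce
  then have "\<Phi> = A \<union> B"
    by (auto simp: A_def B_def)
  moreover have "\<forall>a\<in>A. \<forall>b\<in>B. a \<bullet> b = 0"
    using orth' by (auto simp: A_def B_def)
  ultimately have "A = {} \<or> B = {}"
    using irred unfolding irreducible_root_system_def by blast
  moreover have "S \<subseteq> A" "\<Delta> - S \<subseteq> B"
    using S simple_is_root by (auto simp: A_def B_def intro: span_base)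
  ultimately show False
    using S \<open>S \<noteq> \<Delta>\<close> by blast
qed

text \<open>By dominance and obtuseness, a simple root outside the support of \<open>\<gamma>\<close> is orthogonal to all
  simple roots in the support, which irreducibility excludes.\<close>

lemma maximal_root_full_support:
  assumes irred: "irreducible_root_system \<Phi>" and max: "maximal_root \<gamma>" and "b \<in> \<Delta>"
  shows "coweight b \<bullet> \<gamma> > 0"
proof -
  define S where "S = {b \<in> \<Delta>. coweight b \<bullet> \<gamma> > 0}"
  have nonneg: "coweight b \<bullet> \<gamma> \<ge> 0" if "b \<in> \<Delta>" for b
    using that maximal_root_positive[OF max] positive_iff by blast
  have subset: "S \<subseteq> \<Delta>"
    by (auto simp: S_def)
  have nonempty: "S \<noteq> {}"
    using positive_root_meets_simple[OF maximal_root_positive[OF max]] by (auto simp: S_def)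
  have orth: "a \<bullet> b = 0" if "a \<in> S" "b \<in> \<Delta> - S" for a b
  proof -
    have summand: "(coweight c \<bullet> \<gamma>) * (c \<bullet> b) \<le> 0" if "c \<in> \<Delta>" for c
    proof (cases "c = b")
      case True
      then show ?thesis
        using \<open>b \<in> \<Delta> - S\<close> nonneg[of b] by (force simp: S_def)
    next
      case False
      then show ?thesis
        using that \<open>b \<in> \<Delta> - S\<close> nonneg[of c] simple_roots_obtuse[of c b]
        by (simp add: mult_nonneg_nonpos)
    qed
    have "(\<Sum>c\<in>\<Delta>. (coweight c \<bullet> \<gamma>) * (c \<bullet> b)) \<ge> 0"
      using maximal_root_dominant[OF max, of b] \<open>b \<in> \<Delta> - S\<close> inner_simple_expansion[of \<gamma> b]
      by (simp add: inner_commute)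
    then have "\<forall>c\<in>\<Delta>. (coweight c \<bullet> \<gamma>) * (c \<bullet> b) = 0"
      using sum_nonneg_eq_0_iff[OF finite_simple, of "\<lambda>c. - ((coweight c \<bullet> \<gamma>) * (c \<bullet> b))"]
        summand sum_nonpos[of \<Delta> "\<lambda>c. (coweight c \<bullet> \<gamma>) * (c \<bullet> b)"]
      by (simp add: sum_negf)
    then show ?thesis
      using \<open>a \<in> S\<close> by (auto simp: S_def)
  qed
  have "S = \<Delta>"
    using irred subset nonempty orth by (rule irreducible_simple)
  then show ?thesis
    using \<open>b \<in> \<Delta>\<close> by (auto simp: S_def)
qed

text \<open>By the Cauchy--Schwarz inequality the Cartan integers of two non-proportional roots have
  product less than four, so one of them is one when the angle is acute.\<close>

lemma acute_roots_difference:
  assumes "\<alpha> \<in> \<Phi>" "\<beta> \<in> \<Phi>" "\<alpha> \<bullet> \<beta> > 0" "\<alpha> \<noteq> \<beta>"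
  shows "\<alpha> - \<beta> \<in> \<Phi>"
proof -
  have pos: "\<alpha> \<bullet> \<alpha> > 0" "\<beta> \<bullet> \<beta> > 0"
    using assms root_nonzero by auto
  obtain m n :: int where m: "coroot \<alpha> \<bullet> \<beta> = m" and n: "coroot \<beta> \<bullet> \<alpha> = n"
    using assms coroot_integral by (metis Ints_cases)
  have "real_of_int m > 0" "real_of_int n > 0"
    using assms root_nonzero coroot_inner_pos_iff(1) by (metis inner_commute m n)+
  then have mn: "m > 0" "n > 0"
    by auto
  have not_prop: "(\<alpha> \<bullet> \<beta>)\<^sup>2 \<noteq> (\<alpha> \<bullet> \<alpha>) * (\<beta> \<bullet> \<beta>)"
  proof
    assume "(\<alpha> \<bullet> \<beta>)\<^sup>2 = (\<alpha> \<bullet> \<alpha>) * (\<beta> \<bullet> \<beta>)"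
    then have "norm (\<alpha> - ((\<alpha> \<bullet> \<beta>) / (\<beta> \<bullet> \<beta>)) *\<^sub>R \<beta>) = 0"
      using pos by (simp add: norm_eq_sqrt_inner inner_diff_left inner_diff_right inner_commute
          field_simps power2_eq_square)
    then have eq: "\<alpha> = ((\<alpha> \<bullet> \<beta>) / (\<beta> \<bullet> \<beta>)) *\<^sub>R \<beta>"
      by simp
    then have "(\<alpha> \<bullet> \<beta>) / (\<beta> \<bullet> \<beta>) = 1 \<or> (\<alpha> \<bullet> \<beta>) / (\<beta> \<bullet> \<beta>) = -1"
      using assms(1,2) root_multiple by metis
    moreover have "(\<alpha> \<bullet> \<beta>) / (\<beta> \<bullet> \<beta>) > 0"
      using pos assms by simp
    ultimately have "(\<alpha> \<bullet> \<beta>) / (\<beta> \<bullet> \<beta>) = 1"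
      by linarith
    with eq have "\<alpha> = 1 *\<^sub>R \<beta>"
      by metis
    then show False
      using assms(4) by simp
  qed
  have "(\<alpha> \<bullet> \<beta>)\<^sup>2 < (\<alpha> \<bullet> \<alpha>) * (\<beta> \<bullet> \<beta>)"
    using Cauchy_Schwarz_ineq[of \<alpha> \<beta>] not_prop by simp
  moreover have "real_of_int m * real_of_int n = 4 * (\<alpha> \<bullet> \<beta>)\<^sup>2 / ((\<alpha> \<bullet> \<alpha>) * (\<beta> \<bullet> \<beta>))"
    unfolding m[symmetric] n[symmetric]
    by (simp add: coroot_def inner_commute power2_eq_square)
  ultimately have "real_of_int m * real_of_int n < 4"
    using pos by (simp add: pos_divide_less_eq)
  then have "m * n < 4"
    by (metis of_int_less_numeral_iff of_int_mult)
  then have "m = 1 \<or> n = 1"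
    using mn mult_mono[of 2 m 2 n] by linarith
  then show ?thesis
  proof
    assume "m = 1"
    then have "root_reflection \<alpha> \<beta> = - (\<alpha> - \<beta>)"
      using m by (simp add: root_reflection_def)
    then show ?thesis
      using reflection_root[OF assms(1,2)] minus_root by fastforce
  next
    assume "n = 1"
    then have "root_reflection \<beta> \<alpha> = \<alpha> - \<beta>"
      using n by (simp add: root_reflection_def)
    then show ?thesis
      using reflection_root[OF assms(2,1)] by simp
  qed
qed

text \<open>Two maximal roots are dominant with full support, so they form an acute angle. If they were distinct,
  their difference would be a positive or a negative root, making them comparable. Hence there
  is only one maximal root, and every root lies below it.\<close>

lemma exists_highest_root:
  assumes irred: "irreducible_root_system \<Phi>"
  shows "\<exists>\<theta>. highest \<theta>"
proof -
  have unique: "\<gamma> = \<gamma>'" if max: "maximal_root \<gamma>" "maximal_root \<gamma>'" for \<gamma> \<gamma>'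
  proof (rule ccontr)
    assume "\<gamma> \<noteq> \<gamma>'"
    have roots: "\<gamma> \<in> \<Phi>" "\<gamma>' \<in> \<Phi>"
      using max by (auto simp: maximal_root_def)
    obtain a where a: "a \<in> \<Delta>" "a \<bullet> \<gamma> > 0"
      using positive_root_meets_simple[OF maximal_root_positive[OF max(1)]] by blast
    have "(\<Sum>b\<in>\<Delta>. (coweight b \<bullet> \<gamma>') * (b \<bullet> \<gamma>)) > 0"
    proof (rule sum_pos2[OF finite_simple a(1)])
      show "coweight a \<bullet> \<gamma>' * (a \<bullet> \<gamma>) > 0"
        using a maximal_root_full_support[OF irred max(2)] by simp
      show "coweight b \<bullet> \<gamma>' * (b \<bullet> \<gamma>) \<ge> 0" if "b \<in> \<Delta>" for b
        using that maximal_root_full_support[OF irred max(2), of b]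
          maximal_root_dominant[OF max(1)] by simp
    qed
    then have "\<gamma> \<bullet> \<gamma>' > 0"
      using inner_simple_expansion[of \<gamma>' \<gamma>] by (simp add: inner_commute)
    then have "\<gamma> - \<gamma>' \<in> \<Phi>"
      using acute_roots_difference roots \<open>\<gamma> \<noteq> \<gamma>'\<close> by blast
    then consider "\<gamma> - \<gamma>' \<in> \<Phi>p" | "- (\<gamma> - \<gamma>') \<in> \<Phi>p"
      using positive_or_negative by blast
    then show False
    proof cases
      case 1
      then have "\<forall>b\<in>\<Delta>. coweight b \<bullet> \<gamma>' \<le> coweight b \<bullet> \<gamma>"
        by (auto simp: positive_iff inner_diff_right)
      then show False
        using max(2) roots \<open>\<gamma> \<noteq> \<gamma>'\<close> by (auto simp: maximal_root_def)
    next
      case 2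
      then have "\<forall>b\<in>\<Delta>. coweight b \<bullet> \<gamma> \<le> coweight b \<bullet> \<gamma>'"
        by (auto simp: positive_iff inner_diff_right)
      then show False
        using max(1) roots \<open>\<gamma> \<noteq> \<gamma>'\<close> by (auto simp: maximal_root_def)
    qed
  qed
  have "\<Phi> \<noteq> {}"
  proof
    assume "\<Phi> = {}"
    then have "(UNIV :: 'a set) = {0}"
      using roots_span by simp
    then show False
      using nonempty_Basis nonzero_Basis by blast
  qed
  then obtain \<theta> where \<theta>: "maximal_root \<theta>"
    using below_maximal_root by (metis ex_in_conv)
  have "\<forall>b\<in>\<Delta>. coweight b \<bullet> \<beta> \<le> coweight b \<bullet> \<theta>" if "\<beta> \<in> \<Phi>" for \<beta>
    using below_maximal_root[OF that] unique[OF \<theta>] by metis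
  then show ?thesis
    using \<theta> by (auto simp: highest_def maximal_root_def)
qed

end


section \<open>Affine roots\<close>

lemma affine_reflection_pair:
  "affine_reflection b x =
     (root_reflection (fst b) (fst x), snd x - (coroot (fst b) \<bullet> fst x) * snd b)"
  by (simp add: affine_reflection_def affine_pairing_def root_reflection_def prod_eq_iff)

lemma affine_reflection_involution [simp]: "affine_reflection b (affine_reflection b x) = x"
proof (cases "fst b = 0")
  case True
  then show ?thesis
    by (simp add: affine_reflection_pair coroot_def root_reflection_def)
next
  case False
  then have "coroot (fst b) \<bullet> fst b = 2"
    by (simp add: coroot_inner)
  then show ?thesis
    by (simp add: affine_reflection_pair prod_eq_iff inner_root_reflection algebra_simps)
qed

lemma affine_pairing_reflections:
  "affine_pairing (affine_reflection b \<beta>) (affine_reflection b x) = affine_pairing \<beta> x"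
  using orthogonal_root_reflection[of "fst b"]
  by (simp add: affine_pairing_def affine_reflection_pair orthogonal_coroot)
     (simp add: orthogonal_transformation_def)

lemma affine_pairing_reflected:
  "affine_pairing b (affine_reflection \<beta> x) =
     affine_pairing b x - affine_pairing \<beta> x * affine_pairing b \<beta>"
  by (simp add: affine_pairing_def affine_reflection_pair inner_root_reflection)

lemma affine_pairing_self: "fst b \<noteq> 0 \<Longrightarrow> affine_pairing b b = 2"
  by (simp add: affine_pairing_def coroot_inner)

lemma affine_reflection_conjugate:
  "affine_reflection b (affine_reflection \<beta> x) =
     affine_reflection (affine_reflection b \<beta>) (affine_reflection b x)"
proof -
  have "affine_reflection b (affine_reflection \<beta> x) =
      affine_reflection b x - affine_pairing \<beta> x *\<^sub>R affine_reflection b \<beta>"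
    by (simp only: affine_reflection_def[of b] affine_pairing_reflected)
       (simp add: affine_reflection_def algebra_simps)
  then show ?thesis
    by (simp only: affine_reflection_def[of "affine_reflection b \<beta>"] affine_pairing_reflections)
qed


section \<open>The semi-infinite length\<close>

context based_root_system begin

lemma affine_positive_iff:
  "\<beta> \<in> affine_positive_roots \<Phi> \<Delta> \<longleftrightarrow>
     fst \<beta> \<in> \<Phi> \<and> snd \<beta> \<in> \<int> \<and> (snd \<beta> > 0 \<or> snd \<beta> = 0 \<and> fst \<beta> \<in> \<Phi>p)"
proof -
  obtain \<alpha> x where \<beta>: "\<beta> = (\<alpha>, x)"
    by (cases \<beta>)
  show ?thesis
    unfolding \<beta> affine_positive_roots_def of_finite_def \<delta>_def
    by (auto simp: positive_is_root image_iff elim!: Ints_cases)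
qed

abbreviation "affine_positive \<equiv> affine_positive_roots \<Phi> \<Delta>"

text \<open>For \<open>\<eta> = w \<Lambda>\<close> this is the length of the minimal representative of the coset of \<open>w\<close>, and
  \<open>positive_sum \<eta>\<close> below is the image of \<open>2 \<rho> - 2 \<rho>\<^sub>J\<close> under \<open>w\<close>. Both make sense without choosing \<open>w\<close>.\<close>

definition inversions :: "'a \<Rightarrow> nat" where
  "inversions \<eta> = card {\<beta> \<in> \<Phi>p. \<beta> \<bullet> \<eta> < 0}"

definition positive_sum :: "'a \<Rightarrow> 'a" where
  "positive_sum \<eta> = (\<Sum>\<beta> | \<beta> \<in> \<Phi> \<and> \<beta> \<bullet> \<eta> > 0. \<beta>)"

lemma inversions_sum: "real (inversions \<eta>) = (\<Sum>\<beta>\<in>\<Phi>p. of_bool (\<beta> \<bullet> \<eta> < 0))"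
  using finite_positive by (simp add: inversions_def Int_def)

lemma positive_sum_sgn: "positive_sum \<eta> = (\<Sum>\<beta>\<in>\<Phi>p. sgn (\<beta> \<bullet> \<eta>) *\<^sub>R \<beta>)"
proof -
  have "positive_sum \<eta> = (\<Sum>\<beta>\<in>\<Phi>. if \<beta> \<bullet> \<eta> > 0 then \<beta> else 0)"
    unfolding positive_sum_def using finite_roots by (simp add: sum.inter_filter)
  also have "\<dots> = (\<Sum>\<beta>\<in>\<Phi>p. sgn (\<beta> \<bullet> \<eta>) *\<^sub>R \<beta>)"
    unfolding sum_roots_via_positive by (rule sum.cong) (auto simp: sgn_if)
  finally show ?thesis .
qed

lemma positive_sum_equivariant:
  assumes "orthogonal_transformation g" "g ` \<Phi> = \<Phi>"
  shows "positive_sum (g \<eta>) = g (positive_sum \<eta>)"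
proof -
  have inj: "inj g"
    using assms(1) by (rule orthogonal_transformation_inj)
  have inner: "g x \<bullet> g y = x \<bullet> y" for x y
    using assms(1) by (simp add: orthogonal_transformation_def)
  have "{\<beta>. \<beta> \<in> \<Phi> \<and> \<beta> \<bullet> g \<eta> > 0} = g ` {\<beta>. \<beta> \<in> \<Phi> \<and> \<beta> \<bullet> \<eta> > 0}"
    using assms(2) inner by (auto simp: image_iff) (metis imageE inner)
  then have "positive_sum (g \<eta>) = (\<Sum>\<beta> | \<beta> \<in> \<Phi> \<and> \<beta> \<bullet> \<eta> > 0. g \<beta>)"
    unfolding positive_sum_def using inj by (simp add: sum.reindex inj_on_subset[OF inj])
  also have "\<dots> = g (positive_sum \<eta>)"
    unfolding positive_sum_def
    using assms(1) by (simp add: orthogonal_transformation_linear linear_sum)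
  finally show ?thesis .
qed

text \<open>Of the roots that are positive on \<open>\<eta>\<close>, those that stay positive on \<open>\<eta>\<close> under the reflection
  in \<open>\<alpha>\<close> have total inner product \<open>0\<close> with \<open>\<alpha>\<close>; the others, among them \<open>\<alpha>\<close> itself,
  have positive inner product with \<open>\<alpha>\<close>.\<close>

lemma coroot_positive_sum:
  assumes \<alpha>: "\<alpha> \<in> \<Phi>" "\<alpha> \<bullet> \<eta> > 0"
  shows "coroot \<alpha> \<bullet> positive_sum \<eta> > 0"
proof -
  define S where "S = {\<beta> \<in> \<Phi>. \<beta> \<bullet> \<eta> > 0}"
  define T where "T = {\<beta> \<in> S. root_reflection \<alpha> \<beta> \<in> S}"
  have fin: "finite S" "finite T"
    using finite_roots by (auto simp: S_def T_def)
  have refl_inner: "coroot \<alpha> \<bullet> root_reflection \<alpha> \<beta> = - (coroot \<alpha> \<bullet> \<beta>)" for \<beta>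
    using root_nonzero[OF \<alpha>(1)] by (simp add: inner_root_reflection coroot_inner)
  have "(\<Sum>\<beta>\<in>T. coroot \<alpha> \<bullet> \<beta>) = (\<Sum>\<beta>\<in>T. coroot \<alpha> \<bullet> root_reflection \<alpha> \<beta>)"
    by (rule sum.reindex_bij_witness[of _ "root_reflection \<alpha>" "root_reflection \<alpha>"])
       (auto simp: T_def)
  then have T: "(\<Sum>\<beta>\<in>T. coroot \<alpha> \<bullet> \<beta>) = 0"
    by (simp add: refl_inner sum_negf)
  have pos: "coroot \<alpha> \<bullet> \<beta> > 0" if "\<beta> \<in> S - T" for \<beta>
  proof -
    have "root_reflection \<alpha> \<beta> \<bullet> \<eta> \<le> 0" "\<beta> \<bullet> \<eta> > 0"
      using that reflection_root[OF \<alpha>(1), of \<beta>] by (auto simp: S_def T_def)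
    then have "(coroot \<alpha> \<bullet> \<beta>) * (\<alpha> \<bullet> \<eta>) > 0"
      by (simp add: root_reflection_def inner_diff_left)
    then show ?thesis
      using \<alpha>(2) zero_less_mult_pos2 by blast
  qed
  have "\<alpha> \<in> S - T"
    using \<alpha> by (auto simp: S_def T_def root_reflection_self)
  then have "(\<Sum>\<beta>\<in>S - T. coroot \<alpha> \<bullet> \<beta>) > 0"
    using fin pos by (intro sum_pos) auto
  then have "(\<Sum>\<beta>\<in>S. coroot \<alpha> \<bullet> \<beta>) > 0"
    using T sum.subset_diff[of T S "\<lambda>\<beta>. coroot \<alpha> \<bullet> \<beta>"] fin by (auto simp: T_def)
  then show ?thesis
    by (simp add: positive_sum_def S_def inner_sum_right)
qed

lemma inversions_simple_reflection:
  assumes a: "a \<in> \<Delta>"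
  shows "real (inversions (root_reflection a \<eta>)) = real (inversions \<eta>) + sgn (a \<bullet> \<eta>)"
proof -
  have aP: "a \<in> \<Phi>p"
    using a simple_positive by blast
  have perm: "(\<Sum>\<beta>\<in>\<Phi>p - {a}. f (root_reflection a \<beta>)) = (\<Sum>\<beta>\<in>\<Phi>p - {a}. f \<beta>)" for f :: "'a \<Rightarrow> real"
  proof (rule sum.reindex_bij_witness[of _ "root_reflection a" "root_reflection a"])
    fix \<beta> assume \<beta>: "\<beta> \<in> \<Phi>p - {a}"
    have "root_reflection a \<beta> \<noteq> a"
      using \<beta> not_positive_and_negative[OF aP] root_reflection_self root_reflection_involution
      by (metis DiffD1)
    then show "root_reflection a \<beta> \<in> \<Phi>p - {a}"
      using \<beta> simple_reflection_positive[OF a] by blast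
    then show "root_reflection a \<beta> \<in> \<Phi>p - {a}" .
  qed auto
  have "real (inversions (root_reflection a \<eta>)) = (\<Sum>\<beta>\<in>\<Phi>p. of_bool (root_reflection a \<beta> \<bullet> \<eta> < 0))"
    by (simp add: inversions_sum root_reflection_swap)
  also have "\<dots> = of_bool (- a \<bullet> \<eta> < 0) + (\<Sum>\<beta>\<in>\<Phi>p - {a}. of_bool (\<beta> \<bullet> \<eta> < 0))"
    using perm[of "\<lambda>\<beta>. of_bool (\<beta> \<bullet> \<eta> < 0)"]
    by (subst sum.remove[OF finite_positive aP]) (simp add: root_reflection_self)
  also have "\<dots> = real (inversions \<eta>) + sgn (a \<bullet> \<eta>)"
    unfolding inversions_sum by (subst sum.remove[OF finite_positive aP]) (auto simp: sgn_if)
  finally show ?thesis .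
qed

end

locale highest_root_system = based_root_system \<Phi> \<Delta>
  for \<Phi> \<Delta> :: "'a::euclidean_space set" +
  fixes \<theta> :: 'a
  assumes highest: "highest \<theta>"
begin

lemma highest_root: "\<theta> \<in> \<Phi>"
  and highest_ge: "\<beta> \<in> \<Phi> \<Longrightarrow> b \<in> \<Delta> \<Longrightarrow> coweight b \<bullet> \<beta> \<le> coweight b \<bullet> \<theta>"
  using highest by (auto simp: highest_def)

lemma highest_height: "\<beta> \<in> \<Phi> \<Longrightarrow> rho_check \<bullet> \<beta> \<le> rho_check \<bullet> \<theta>"
  unfolding rho_check_inner by (rule sum_mono) (rule highest_ge)

lemma highest_height_eq:
  assumes "\<beta> \<in> \<Phi>" "rho_check \<bullet> \<beta> = rho_check \<bullet> \<theta>"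
  shows "\<beta> = \<theta>"
  using rho_check_zero_iff[of "\<theta> - \<beta>"] assms highest_ge[OF assms(1)]
  by (auto simp: inner_diff_right)

lemma highest_positive: "\<theta> \<in> \<Phi>p"
  using highest_height[OF minus_root[OF highest_root]] rho_check_regular[OF highest_root]
  by (simp add: positive_iff_height highest_root inner_commute)

lemma highest_coroot_nonneg:
  assumes "\<beta> \<in> \<Phi>p"
  shows "coroot \<theta> \<bullet> \<beta> \<ge> 0"
proof -
  have "rho_check \<bullet> root_reflection \<beta> \<theta> \<le> rho_check \<bullet> \<theta>"
    using assms highest_height reflection_root positive_is_root highest_root by blast
  then have "(coroot \<beta> \<bullet> \<theta>) * (rho_check \<bullet> \<beta>) \<ge> 0"
    by (simp add: inner_root_reflection)
  then have "\<not> coroot \<beta> \<bullet> \<theta> < 0"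
    using rho_check_positive[OF assms] by (simp add: zero_le_mult_iff)
  then show ?thesis
    using coroot_inner_pos_iff(2)[OF root_nonzero[OF highest_root]]
      coroot_inner_pos_iff(2)[OF root_nonzero[OF positive_is_root[OF assms]]]
    by (metis inner_commute not_less)
qed

lemma highest_coroot_self: "coroot \<theta> \<bullet> \<theta> = 2"
  using root_nonzero[OF highest_root] by (simp add: coroot_inner)

text \<open>With \<open>m = coroot \<theta> \<bullet> \<beta>\<close>, the root \<open>m \<theta> - \<beta>\<close> is at most \<open>\<theta>\<close>, so that
  \<open>(m - 1) \<theta> \<le> \<beta> \<le> \<theta>\<close>.\<close>

lemma highest_coroot_le_1:
  assumes "\<beta> \<in> \<Phi>p" "\<beta> \<noteq> \<theta>"
  shows "coroot \<theta> \<bullet> \<beta> = 0 \<or> coroot \<theta> \<bullet> \<beta> = 1"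
proof -
  have \<beta>: "\<beta> \<in> \<Phi>"
    using assms(1) by (rule positive_is_root)
  obtain m :: int where m: "coroot \<theta> \<bullet> \<beta> = m"
    using coroot_integral[OF highest_root \<beta>] by (elim Ints_cases)
  have "m \<ge> 0"
    using highest_coroot_nonneg[OF assms(1)] m by simp
  moreover have "m \<le> 1"
  proof (rule ccontr)
    assume "\<not> m \<le> 1"
    then have m2: "real_of_int m \<ge> 2"
      by linarith
    have "rho_check \<bullet> (- root_reflection \<theta> \<beta>) \<le> rho_check \<bullet> \<theta>"
      using highest_height minus_root reflection_root highest_root \<beta> by blast
    then have le: "(real_of_int m - 1) * (rho_check \<bullet> \<theta>) \<le> rho_check \<bullet> \<beta>"
      by (simp add: inner_root_reflection m algebra_simps)
    have "1 * (rho_check \<bullet> \<theta>) \<le> (real_of_int m - 1) * (rho_check \<bullet> \<theta>)"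
      using m2 rho_check_positive[OF highest_positive] by (intro mult_right_mono) auto
    then have "rho_check \<bullet> \<beta> = rho_check \<bullet> \<theta>"
      using le highest_height[OF \<beta>] by simp
    then show False
      using highest_height_eq[OF \<beta>] assms(2) by simp
  qed
  ultimately show ?thesis
    using m by (cases "m = 0") auto
qed

text \<open>The map \<open>\<beta> \<mapsto> - root_reflection \<theta> \<beta>\<close> permutes the positive roots that are not
  orthogonal to \<open>\<theta>\<close>, and the coroot of \<open>\<theta>\<close> takes the value \<open>1\<close> on all of them except \<open>\<theta>\<close> itself,
  where it is \<open>2\<close>. The difference of the inversion numbers and the sum on the right are both sums of
  signs over these roots, and they differ only at \<open>\<theta>\<close>.\<close>

lemma inversions_highest_reflection:
  "real (inversions (root_reflection \<theta> \<eta>)) =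
     real (inversions \<eta>) + coroot \<theta> \<bullet> positive_sum \<eta> - sgn (\<theta> \<bullet> \<eta>)"
proof -
  define P where "P = {\<beta> \<in> \<Phi>p. coroot \<theta> \<bullet> \<beta> \<noteq> 0}"
  have fin: "finite P" and sub: "P \<subseteq> \<Phi>p" and \<theta>P: "\<theta> \<in> P"
    using finite_positive highest_positive highest_coroot_self by (auto simp: P_def)
  have closed: "- root_reflection \<theta> \<beta> \<in> P" if "\<beta> \<in> P" for \<beta>
  proof (cases "\<beta> = \<theta>")
    case True
    then show ?thesis
      using \<theta>P by (simp add: root_reflection_self)
  next
    case False
    then have 1: "coroot \<theta> \<bullet> \<beta> = 1"
      using that highest_coroot_le_1 by (auto simp: P_def)
    have \<beta>: "\<beta> \<in> \<Phi>"
      using that sub positive_is_root by blast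
    have eq: "- root_reflection \<theta> \<beta> = \<theta> - \<beta>"
      using 1 by (simp add: root_reflection_def)
    have "- root_reflection \<theta> \<beta> \<in> \<Phi>"
      using minus_root reflection_root highest_root \<beta> by blast
    then have "\<theta> - \<beta> \<in> \<Phi>p"
      using highest_ge[OF \<beta>] by (simp add: eq positive_iff inner_diff_right)
    moreover have "coroot \<theta> \<bullet> (\<theta> - \<beta>) = 1"
      using 1 highest_coroot_self by (simp add: inner_diff_right)
    ultimately show ?thesis
      by (simp add: eq P_def)
  qed
  have inv: "- root_reflection \<theta> (- root_reflection \<theta> \<beta>) = \<beta>" for \<beta>
    using orthogonal_root_reflection[of \<theta>]
    by (simp add: orthogonal_transformation_linear linear_neg)
  have perm: "(\<Sum>\<beta>\<in>P. f (- root_reflection \<theta> \<beta>)) = (\<Sum>\<beta>\<in>P. f \<beta>)" for f :: "'a \<Rightarrow> real"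
    by (rule sum.reindex_bij_witness[of _ "\<lambda>\<beta>. - root_reflection \<theta> \<beta>" "\<lambda>\<beta>. - root_reflection \<theta> \<beta>"])
       (simp_all only: inv closed)
  have split: "(\<Sum>\<beta>\<in>\<Phi>p. f \<beta>) = (\<Sum>\<beta>\<in>P. f \<beta>) + (\<Sum>\<beta>\<in>\<Phi>p - P. f \<beta>)" for f :: "'a \<Rightarrow> real"
    using sum.subset_diff[OF sub finite_positive, of f] by simp
  have "real (inversions (root_reflection \<theta> \<eta>)) = (\<Sum>\<beta>\<in>\<Phi>p. of_bool (root_reflection \<theta> \<beta> \<bullet> \<eta> < 0))"
    by (simp add: inversions_sum root_reflection_swap)
  also have "\<dots> = (\<Sum>\<beta>\<in>P. of_bool ((- root_reflection \<theta> \<beta>) \<bullet> \<eta> > 0))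
      + (\<Sum>\<beta>\<in>\<Phi>p - P. of_bool (\<beta> \<bullet> \<eta> < 0))"
    unfolding split by (intro arg_cong2[of _ _ _ _ "(+)"] sum.cong) (auto simp: P_def root_reflection_def inner_diff_left)
  also have "\<dots> = (\<Sum>\<beta>\<in>P. of_bool (\<beta> \<bullet> \<eta> > 0)) + (\<Sum>\<beta>\<in>\<Phi>p - P. of_bool (\<beta> \<bullet> \<eta> < 0))"
    by (subst perm[of "\<lambda>\<beta>. of_bool (\<beta> \<bullet> \<eta> > 0)"]) simp
  also have "\<dots> = real (inversions \<eta>) + (\<Sum>\<beta>\<in>P. of_bool (\<beta> \<bullet> \<eta> > 0) - of_bool (\<beta> \<bullet> \<eta> < 0))"
    unfolding inversions_sum split by (simp add: sum_subtractf)
  also have "(\<Sum>\<beta>\<in>P. of_bool (\<beta> \<bullet> \<eta> > 0) - of_bool (\<beta> \<bullet> \<eta> < 0)) = (\<Sum>\<beta>\<in>P. sgn (\<beta> \<bullet> \<eta>))"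
    by (rule sum.cong) (auto simp: sgn_if)
  finally have *: "real (inversions (root_reflection \<theta> \<eta>)) =
      real (inversions \<eta>) + (\<Sum>\<beta>\<in>P. sgn (\<beta> \<bullet> \<eta>))" .
  have "coroot \<theta> \<bullet> positive_sum \<eta> = (\<Sum>\<beta>\<in>\<Phi>p. sgn (\<beta> \<bullet> \<eta>) * (coroot \<theta> \<bullet> \<beta>))"
    by (simp add: positive_sum_sgn inner_sum_right)
  also have "\<dots> = (\<Sum>\<beta>\<in>P. sgn (\<beta> \<bullet> \<eta>) * (coroot \<theta> \<bullet> \<beta>))"
    unfolding split by (simp add: P_def)
  also have "\<dots> = sgn (\<theta> \<bullet> \<eta>) * 2 + (\<Sum>\<beta>\<in>P - {\<theta>}. sgn (\<beta> \<bullet> \<eta>))"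
    by (subst sum.remove[OF fin \<theta>P], subst highest_coroot_self, intro arg_cong2[of _ _ _ _ "(+)"] sum.cong)
       (use highest_coroot_le_1 in \<open>auto simp: P_def\<close>)
  also have "\<dots> = sgn (\<theta> \<bullet> \<eta>) + (\<Sum>\<beta>\<in>P. sgn (\<beta> \<bullet> \<eta>))"
    by (subst sum.remove[OF fin \<theta>P, of "\<lambda>\<beta>. sgn (\<beta> \<bullet> \<eta>)"]) simp
  finally show ?thesis
    using * by simp
qed

definition affine_simple :: "('a \<times> real) set" where
  "affine_simple = insert (- \<theta>, 1) ((\<lambda>a. (a, 0)) ` \<Delta>)"

lemma affine_simple_cases [consumes 1, case_names finite zero]:
  assumes "b \<in> affine_simple"
  obtains a where "a \<in> \<Delta>" "b = (a, 0)" | "b = (- \<theta>, 1)"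
  using assms by (auto simp: affine_simple_def)

lemma affine_simple_positive: "b \<in> affine_simple \<Longrightarrow> b \<in> affine_positive"
  by (erule affine_simple_cases)
     (auto simp: affine_positive_iff simple_is_root simple_positive highest_root minus_root)

lemma affine_root_nonzero: "\<beta> \<in> affine_positive \<Longrightarrow> fst \<beta> \<noteq> 0"
  using root_nonzero by (auto simp: affine_positive_iff)

text \<open>For \<open>b = \<delta> - \<theta>\<close> this rests on the values of the coroot of \<open>\<theta>\<close>: it is at least \<open>-1\<close> on every root
  except \<open>- \<theta>\<close>, and \<open>\<theta> + \<alpha>\<close> is a positive root whenever the value on a negative \<open>\<alpha>\<close> is \<open>-1\<close>.\<close>

lemma affine_simple_permutes:
  assumes b: "b \<in> affine_simple" and \<beta>: "\<beta> \<in> affine_positive" "\<beta> \<noteq> b"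
  shows "affine_reflection b \<beta> \<in> affine_positive"
proof -
  obtain \<alpha> x where \<beta>_eq: "\<beta> = (\<alpha>, x)"
    by (cases \<beta>)
  with \<beta> have \<alpha>: "\<alpha> \<in> \<Phi>" and x: "x \<in> \<int>" and pos: "x > 0 \<or> x = 0 \<and> \<alpha> \<in> \<Phi>p"
    by (auto simp: affine_positive_iff)
  from b show ?thesis
  proof (cases rule: affine_simple_cases)
    case (finite a)
    then show ?thesis
      using \<alpha> x pos \<beta>(2) reflection_root[OF simple_is_root, of a \<alpha>] simple_reflection_positive[of a \<alpha>]
      by (auto simp: affine_reflection_pair affine_positive_iff \<beta>_eq)
  next
    case zero
    have refl: "affine_reflection b \<beta> = (root_reflection \<theta> \<alpha>, x + coroot \<theta> \<bullet> \<alpha>)"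
      by (simp add: zero affine_reflection_pair \<beta>_eq root_reflection_uminus coroot_minus)
    have root: "root_reflection \<theta> \<alpha> \<in> \<Phi>"
      using reflection_root[OF highest_root \<alpha>] .
    obtain n k :: int where n: "x = n" and k: "coroot \<theta> \<bullet> \<alpha> = k"
      using x coroot_integral[OF highest_root \<alpha>] by (elim Ints_cases)
    consider "\<alpha> \<in> \<Phi>p" | "- \<alpha> \<in> \<Phi>p" "- \<alpha> \<noteq> \<theta>" | "- \<alpha> = \<theta>"
      using positive_or_negative[OF \<alpha>] by blast
    then have "n + k > 0 \<or> n + k = 0 \<and> root_reflection \<theta> \<alpha> \<in> \<Phi>p"
    proof cases
      case 1
      then have "k \<ge> 0"
        using highest_coroot_nonneg[OF 1] k by simp
      moreover have "root_reflection \<theta> \<alpha> = \<alpha>" if "k = 0"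
        using that k by (simp add: root_reflection_def)
      ultimately show ?thesis
        using pos n 1 by (cases "k = 0") auto
    next
      case 2
      have "n \<ge> 1"
        using pos n not_positive_and_negative[OF 2(1)] by auto
      have "real_of_int (- k) = real_of_int 0 \<or> real_of_int (- k) = real_of_int 1"
        using highest_coroot_le_1[OF 2] k by simp
      then have "- k = 0 \<or> - k = 1"
        by (simp only: of_int_eq_iff)
      then consider "n + k > 0" | "n + k = 0" "k = - 1"
        using \<open>n \<ge> 1\<close> by linarith
      then show ?thesis
      proof cases
        case 2
        then have "root_reflection \<theta> \<alpha> = \<theta> - (- \<alpha>)"
          using k by (simp add: root_reflection_def)
        moreover from this have "root_reflection \<theta> \<alpha> \<in> \<Phi>p"
          using highest_ge[OF minus_root[OF \<alpha>]] root
          by (force simp: positive_iff inner_add_right)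
        ultimately show ?thesis
          using 2 by simp
      qed simp
    next
      case 3
      then have \<alpha>_eq: "\<alpha> = - \<theta>"
        by auto
      have "n \<ge> 1"
        using pos n not_positive_and_negative[OF highest_positive] \<alpha>_eq by auto
      moreover have "n \<noteq> 1"
        using \<beta>(2) zero \<beta>_eq n \<alpha>_eq by auto
      moreover have "k = - 2"
        using k highest_coroot_self by (simp add: \<alpha>_eq)
      moreover have "root_reflection \<theta> \<alpha> = \<theta>"
        using root_reflection_involution[of \<theta> \<theta>] by (simp add: \<alpha>_eq root_reflection_self)
      ultimately show ?thesis
        using highest_positive by auto
    qed
    then show ?thesis
      using root n k by (auto simp: refl affine_positive_iff)
  qed
qed

text \<open>If no simple root has positive inner product with \<open>\<alpha>\<close>, then pairing \<open>\<theta> + \<alpha> \<ge> 0\<close>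
  with \<open>\<alpha>\<close> shows that \<open>- \<theta>\<close> has.\<close>

lemma affine_simple_meets:
  assumes \<beta>: "\<beta> \<in> affine_positive"
  obtains b where "b \<in> affine_simple" "affine_pairing b \<beta> > 0"
proof -
  obtain \<alpha> x where \<beta>_eq: "\<beta> = (\<alpha>, x)"
    by (cases \<beta>)
  with \<beta> have \<alpha>: "\<alpha> \<in> \<Phi>"
    by (auto simp: affine_positive_iff)
  show ?thesis
  proof (cases "\<exists>a\<in>\<Delta>. a \<bullet> \<alpha> > 0")
    case True
    then obtain a where a: "a \<in> \<Delta>" "a \<bullet> \<alpha> > 0"
      by blast
    then have "coroot a \<bullet> \<alpha> > 0"
      using coroot_inner_pos_iff(1)[OF root_nonzero, OF simple_is_root] by blast
    with a show ?thesis
      by (intro that[of "(a, 0)"]) (auto simp: affine_simple_def affine_pairing_def \<beta>_eq)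
  next
    case False
    have "coweight b \<bullet> (\<theta> + \<alpha>) \<ge> 0" if "b \<in> \<Delta>" for b
      using highest_ge[OF minus_root[OF \<alpha>] that] by (simp add: inner_add_right)
    then have "(\<Sum>b\<in>\<Delta>. (coweight b \<bullet> (\<theta> + \<alpha>)) * (b \<bullet> \<alpha>)) \<le> 0"
      using False by (intro sum_nonpos mult_nonneg_nonpos) (auto simp: not_less)
    then have "(\<theta> + \<alpha>) \<bullet> \<alpha> \<le> 0"
      by (simp only: inner_simple_expansion[of "\<theta> + \<alpha>"])
    then have "\<theta> \<bullet> \<alpha> < 0"
      using root_nonzero[OF \<alpha>] inner_gt_zero_iff[of \<alpha>] inner_add_left[of \<theta> \<alpha> \<alpha>] by linarith
    then have "coroot (- \<theta>) \<bullet> \<alpha> > 0"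
      using coroot_inner_pos_iff(2)[OF root_nonzero[OF highest_root]] by (simp add: coroot_minus)
    then show ?thesis
      by (intro that[of "(- \<theta>, 1)"]) (auto simp: affine_simple_def affine_pairing_def \<beta>_eq)
  qed
qed

text \<open>The height on the affine root lattice, for which the affine simple roots have height \<open>1\<close>.\<close>

definition affine_height :: "'a \<times> real \<Rightarrow> real" where
  "affine_height \<beta> = rho_check \<bullet> fst \<beta> + (1 + rho_check \<bullet> \<theta>) * snd \<beta>"

lemma affine_height_linear:
  "affine_height (x + y) = affine_height x + affine_height y"
  "affine_height (x - y) = affine_height x - affine_height y"
  "affine_height (c *\<^sub>R x) = c * affine_height x"
  by (simp_all add: affine_height_def inner_add_right inner_diff_right algebra_simps)

lemma affine_height_simple: "b \<in> affine_simple \<Longrightarrow> affine_height b = 1"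
  by (erule affine_simple_cases) (auto simp: affine_height_def rho_check_simple)

lemma affine_height_integral: "\<beta> \<in> affine_positive \<Longrightarrow> affine_height \<beta> \<in> \<int>"
  using height_integral[OF highest_root] height_integral[of "fst \<beta>"]
  by (auto simp: affine_height_def affine_positive_iff)

lemma affine_height_positive:
  assumes "\<beta> \<in> affine_positive"
  shows "affine_height \<beta> > 0"
proof (cases "snd \<beta> = 0")
  case True
  then show ?thesis
    using assms rho_check_positive by (auto simp: affine_height_def affine_positive_iff)
next
  case False
  then have "snd \<beta> \<ge> 1" and root: "- fst \<beta> \<in> \<Phi>"
    using assms minus_root by (auto simp: affine_positive_iff elim!: Ints_cases)
  then have "(1 + rho_check \<bullet> \<theta>) * 1 \<le> (1 + rho_check \<bullet> \<theta>) * snd \<beta>"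
    using rho_check_positive[OF highest_positive] by (intro mult_left_mono) auto
  then show ?thesis
    using highest_height[OF root] by (simp add: affine_height_def)
qed

text \<open>For \<open>\<mu> = w t\<^sub>\<tau> \<Lambda>\<close> with finite part \<open>\<eta>\<close> and \<open>w\<close> a minimal coset representative, this is the
  change of the semi-infinite length \<open>\<ell>(w) + \<langle>\<tau>, 2 \<rho> - 2 \<rho>\<^sub>J\<rangle>\<close> when \<open>\<mu>\<close> is reflected in \<open>\<beta>\<close>. Unlike the
  length, the change does not involve \<open>\<tau>\<close>.\<close>

definition length_gain :: "'a \<times> real \<Rightarrow> 'a \<Rightarrow> real" where
  "length_gain \<beta> \<eta> = real (inversions (root_reflection (fst \<beta>) \<eta>)) - real (inversions \<eta>)
     + snd \<beta> * (coroot (fst \<beta>) \<bullet> positive_sum \<eta>)"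

text \<open>The term with \<open>positive_sum\<close> makes the finite and the affine simple reflection behave alike.\<close>

lemma length_gain_simple:
  assumes "b \<in> affine_simple"
  shows "length_gain b \<eta> = sgn (fst b \<bullet> \<eta>)"
  using assms
proof (cases rule: affine_simple_cases)
  case (finite a)
  then show ?thesis
    using inversions_simple_reflection[of a \<eta>] by (simp add: length_gain_def)
next
  case zero
  then show ?thesis
    using inversions_highest_reflection[of \<eta>]
    by (simp add: length_gain_def root_reflection_uminus coroot_minus sgn_minus)
qed

text \<open>The two ends of the step are \<open>\<mu>\<close> and \<open>\<nu>\<close>, and reflecting in \<open>b\<close> changes their semi-infinite
  lengths by the signs of their pairings with \<open>b\<close>.\<close>

lemma length_gain_conjugate:
  assumes b: "b \<in> affine_simple" and \<beta>: "fst \<beta> \<in> \<Phi>"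
  shows "length_gain (affine_reflection b \<beta>) (root_reflection (fst b) \<eta>) =
    length_gain \<beta> \<eta> + sgn (fst b \<bullet> root_reflection (fst \<beta>) \<eta>) - sgn (fst b \<bullet> \<eta>)"
proof -
  let ?r = "root_reflection (fst b)" and ?s = "root_reflection (fst \<beta>)"
  have root: "fst b \<in> \<Phi>"
    using affine_simple_positive[OF b] by (simp add: affine_positive_iff)
  note orth = orthogonal_root_reflection[of "fst b"]
  have shift: "real (inversions (?r \<xi>)) =
      real (inversions \<xi>) + sgn (fst b \<bullet> \<xi>) - snd b * (coroot (fst b) \<bullet> positive_sum \<xi>)" for \<xi>
    using length_gain_simple[OF b, of \<xi>] by (simp add: length_gain_def)
  have refl: "root_reflection (?r (fst \<beta>)) (?r \<eta>) = ?r (?s \<eta>)"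
    using orthogonal_conjugates_reflection[OF orth] by simp
  have inner: "coroot (?r (fst \<beta>)) \<bullet> positive_sum (?r \<eta>) = coroot (fst \<beta>) \<bullet> positive_sum \<eta>"
    using positive_sum_equivariant[OF orth reflection_roots[OF root]] orth
    by (simp add: orthogonal_coroot) (simp add: orthogonal_transformation_def)
  have moved: "coroot (fst b) \<bullet> positive_sum (?s \<eta>) = coroot (fst b) \<bullet> positive_sum \<eta>
      - (coroot (fst \<beta>) \<bullet> positive_sum \<eta>) * (coroot (fst b) \<bullet> fst \<beta>)"
    using positive_sum_equivariant[OF orthogonal_root_reflection reflection_roots[OF \<beta>]]
    by (simp add: inner_root_reflection)
  show ?thesis
    unfolding length_gain_def affine_reflection_pair fst_conv snd_conv refl inner shift moved
    by (simp add: algebra_simps)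
qed

text \<open>Conjugating by an affine simple root \<open>b\<close> that makes an acute angle with \<open>\<beta>\<close> lowers \<open>\<beta>\<close>.\<close>

lemma affine_root_induct [consumes 1, case_names simple reflect]:
  assumes "\<beta> \<in> affine_positive"
    and simple: "\<And>b x. b \<in> affine_simple \<Longrightarrow> P b x"
    and reflect: "\<And>\<beta> b x. \<beta> \<in> affine_positive \<Longrightarrow> b \<in> affine_simple \<Longrightarrow> \<beta> \<noteq> b \<Longrightarrow>
       affine_pairing b \<beta> > 0 \<Longrightarrow> affine_reflection b \<beta> \<in> affine_positive \<Longrightarrow>
       P (affine_reflection b \<beta>) (affine_reflection b x) \<Longrightarrow> P \<beta> x"
  shows "P \<beta> x"
  using assms(1)
proof (induction "nat \<lfloor>affine_height \<beta>\<rfloor>" arbitrary: \<beta> x rule: less_induct)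
  case less
  obtain b where b: "b \<in> affine_simple" "affine_pairing b \<beta> > 0"
    using less.prems by (rule affine_simple_meets)
  show ?case
  proof (cases "\<beta> = b")
    case True
    then show ?thesis
      using b simple by simp
  next
    case False
    have pos: "affine_reflection b \<beta> \<in> affine_positive"
      using affine_simple_permutes b less.prems False by blast
    have "affine_height (affine_reflection b \<beta>) < affine_height \<beta>"
      using b by (simp add: affine_reflection_def affine_height_linear affine_height_simple)
    moreover have "affine_height (affine_reflection b \<beta>) \<in> \<int>" "affine_height \<beta> \<in> \<int>"
      using pos less.prems affine_height_integral by auto
    ultimately have "nat \<lfloor>affine_height (affine_reflection b \<beta>)\<rfloor> < nat \<lfloor>affine_height \<beta>\<rfloor>"
      using affine_height_positive[OF pos] by (elim Ints_cases) simp
    then show ?thesis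
      using less.hyps pos reflect[OF less.prems b(1) False b(2) pos] by blast
  qed
qed

end


section \<open>The Weyl group and minimal coset representatives\<close>

lemma weyl_word_Nil: "weyl_word [] = id"
  and weyl_word_Cons: "weyl_word (a # as) = root_reflection a \<circ> weyl_word as"
  by (simp_all add: weyl_word_def)

lemma weyl_word_append: "weyl_word (as @ bs) = weyl_word as \<circ> weyl_word bs"
  by (induction as) (simp_all add: weyl_word_Nil weyl_word_Cons comp_assoc)

lemma weyl_id: "id \<in> weyl K"
  unfolding weyl_def by (rule image_eqI[of _ _ "[]"]) (simp_all add: weyl_word_Nil)

lemma weyl_comp:
  assumes "v \<in> weyl K" "w \<in> weyl K"
  shows "v \<circ> w \<in> weyl K"
proof -
  obtain as bs where "as \<in> lists K" "v = weyl_word as" "bs \<in> lists K" "w = weyl_word bs"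
    using assms by (auto simp: weyl_def)
  then show ?thesis
    unfolding weyl_def by (intro image_eqI[of _ _ "as @ bs"]) (simp_all add: weyl_word_append)
qed

lemma weyl_simple_reflection: "a \<in> K \<Longrightarrow> root_reflection a \<in> weyl K"
  unfolding weyl_def by (rule image_eqI[of _ _ "[a]"]) (simp_all add: weyl_word_Nil weyl_word_Cons)

lemma weyl_mono: "J \<subseteq> K \<Longrightarrow> weyl J \<subseteq> weyl K"
  unfolding weyl_def by (intro image_mono lists_mono)

lemma weyl_induct [consumes 1, case_names id reflect]:
  assumes "w \<in> weyl K" "P id"
    and "\<And>a w. a \<in> K \<Longrightarrow> w \<in> weyl K \<Longrightarrow> P w \<Longrightarrow> P (root_reflection a \<circ> w)"
  shows "P w"
proof -
  have "P (weyl_word as)" if "as \<in> lists K" for as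
    using that
  proof (induction as)
    case Nil
    then show ?case
      using assms(2) by (simp only: weyl_word_Nil)
  next
    case (Cons a as)
    then have "a \<in> K" "weyl_word as \<in> weyl K" "P (weyl_word as)"
      by (auto simp: weyl_def)
    then show ?case
      unfolding weyl_word_Cons by (rule assms(3))
  qed
  then show ?thesis
    using assms(1) by (auto simp: weyl_def)
qed

lemma weyl_orthogonal: "w \<in> weyl K \<Longrightarrow> orthogonal_transformation w"
proof (induction rule: weyl_induct)
  case id
  then show ?case
    by (simp add: id_def)
next
  case (reflect a w)
  then show ?case
    using orthogonal_transformation_compose[OF orthogonal_root_reflection] by blast
qed

lemma weyl_inner: "w \<in> weyl K \<Longrightarrow> w x \<bullet> w y = x \<bullet> y"
  using weyl_orthogonal by (auto simp: orthogonal_transformation_def)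

lemma weyl_linear: "w \<in> weyl K \<Longrightarrow> linear w"
  using weyl_orthogonal by (auto simp: orthogonal_transformation_def)

lemma weyl_minus: "w \<in> weyl K \<Longrightarrow> w (- x) = - w x"
  by (simp add: weyl_linear linear_neg)

lemma weyl_bij: "w \<in> weyl K \<Longrightarrow> bij w"
  using weyl_orthogonal orthogonal_transformation_bij by blast

lemma weyl_conjugates_reflection:
  assumes "w \<in> weyl K"
  shows "w \<circ> root_reflection \<alpha> = root_reflection (w \<alpha>) \<circ> w"
  using orthogonal_conjugates_reflection[OF weyl_orthogonal[OF assms]] by (simp add: fun_eq_iff)

lemma weyl_inv:
  assumes "w \<in> weyl K"
  shows "inv w \<in> weyl K"
  using assms
proof (induction rule: weyl_induct)
  case id
  then show ?case
    by (simp only: inv_id weyl_id)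
next
  case (reflect a w)
  have "inv (root_reflection a) = root_reflection a"
    by (rule inv_unique_comp) (simp_all add: fun_eq_iff)
  moreover have "bij (root_reflection a)"
    using reflect(1) weyl_simple_reflection weyl_bij by blast
  ultimately have "inv (root_reflection a \<circ> w) = inv w \<circ> root_reflection a"
    using weyl_bij[OF reflect(2)] by (simp add: o_inv_distrib)
  then show ?case
    using reflect weyl_comp weyl_simple_reflection by metis
qed

lemma weyl_inv_apply:
  assumes "w \<in> weyl K"
  shows "w (inv w x) = x" "inv w (w x) = x"
  using weyl_bij[OF assms] by (simp_all add: bij_is_surj surj_f_inv_f bij_is_inj)

lemma weyl_inner_inv:
  assumes "w \<in> weyl K"
  shows "x \<bullet> w y = inv w x \<bullet> y"
  using weyl_inner[OF assms, of "inv w x" y] weyl_inv_apply[OF assms] by simp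

context based_root_system begin

lemma weyl_roots: "w \<in> weyl \<Delta> \<Longrightarrow> w ` \<Phi> = \<Phi>"
  by (induction rule: weyl_induct)
     (simp, simp only: image_comp[symmetric] reflection_roots simple_is_root)

lemma weyl_root: "w \<in> weyl \<Delta> \<Longrightarrow> \<alpha> \<in> \<Phi> \<Longrightarrow> w \<alpha> \<in> \<Phi>"
  using weyl_roots by blast

lemma reflection_in_weyl:
  assumes "\<alpha> \<in> \<Phi>"
  shows "root_reflection \<alpha> \<in> weyl \<Delta>"
proof -
  have *: "root_reflection \<alpha> \<in> weyl \<Delta>" if "\<alpha> \<in> \<Phi>p" for \<alpha>
    using that
  proof (induction rule: positive_root_induct)
    case (simple a)
    then show ?case
      by (rule weyl_simple_reflection)
  next
    case (reflect \<alpha> a)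
    let ?r = "root_reflection a"
    have "root_reflection \<alpha> = ?r \<circ> (root_reflection (?r \<alpha>) \<circ> ?r)"
      using orthogonal_conjugates_reflection[OF orthogonal_root_reflection, of a \<alpha>]
      by (auto simp: fun_eq_iff) (metis root_reflection_involution)
    then show ?case
      using reflect weyl_comp weyl_simple_reflection by metis
  qed
  show ?thesis
    using positive_or_negative[OF assms] *[of \<alpha>] *[of "- \<alpha>"] by (auto simp: root_reflection_uminus)
qed

lemma weyl_length_le: "as \<in> lists \<Delta> \<Longrightarrow> weyl_length \<Delta> (weyl_word as) \<le> length as"
  unfolding weyl_length_def by (rule Least_le) blast

lemma weyl_length_word:
  assumes "w \<in> weyl \<Delta>"
  obtains as where "as \<in> lists \<Delta>" "length as = weyl_length \<Delta> w" "weyl_word as = w"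
proof -
  have "\<exists>n. \<exists>as\<in>lists \<Delta>. length as = n \<and> weyl_word as = w"
    using assms by (auto simp: weyl_def)
  from LeastI_ex[OF this] show ?thesis
    using that unfolding weyl_length_def by blast
qed

text \<open>Strong exchange condition. Applying the letters to \<open>\<alpha>\<close> one after the other turns it negative
  at some point. A simple reflection makes only its own root negative, so at that point the
  transported root is the current letter, and this letter can be dropped.\<close>

lemma exchange:
  assumes "as \<in> lists \<Delta>" "\<alpha> \<in> \<Phi>p" "\<alpha> \<bullet> weyl_word as rho_check < 0"
  shows "\<exists>bs\<in>lists \<Delta>. length as = Suc (length bs) \<and> root_reflection \<alpha> \<circ> weyl_word as = weyl_word bs"
  using assms
proof (induction as arbitrary: \<alpha>)
  case Nil
  then show ?case
    using rho_check_positive[of \<alpha>] by (simp add: weyl_word_Nil inner_commute)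
next
  case (Cons a as)
  show ?case
  proof (cases "\<alpha> = a")
    case True
    then have "root_reflection \<alpha> \<circ> weyl_word (a # as) = weyl_word as"
      by (simp add: weyl_word_Cons fun_eq_iff)
    then show ?thesis
      using Cons.hyps(2) Cons.prems(1) by (intro bexI[of _ as]) auto
  next
    case False
    let ?r = "root_reflection a"
    have "?r \<alpha> \<in> \<Phi>p"
      using simple_reflection_positive[of a \<alpha>] False Cons by auto
    moreover have "?r \<alpha> \<bullet> weyl_word as rho_check < 0"
      using Cons.prems by (simp add: weyl_word_Cons root_reflection_swap)
    ultimately obtain bs where bs: "bs \<in> lists \<Delta>" "length as = Suc (length bs)"
      "root_reflection (?r \<alpha>) \<circ> weyl_word as = weyl_word bs"
      using Cons.IH by blast
    have "root_reflection \<alpha> (?r x) = ?r (root_reflection (?r \<alpha>) x)" for x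
      using orthogonal_conjugates_reflection[OF orthogonal_root_reflection, of a "?r \<alpha>" x] by simp
    then have "root_reflection \<alpha> \<circ> weyl_word (a # as) = weyl_word (a # bs)"
      unfolding weyl_word_Cons bs(3)[symmetric] by (simp add: fun_eq_iff)
    then show ?thesis
      using bs Cons by (intro bexI[of _ "a # bs"]) auto
  qed
qed

text \<open>In a reduced word every letter adds one inversion to those of the word on its right, since
  otherwise the exchange condition would shorten the word.\<close>

lemma weyl_length_inversions:
  assumes "w \<in> weyl \<Delta>"
  shows "weyl_length \<Delta> w = inversions (w rho_check)"
proof -
  have reduced: "inversions (weyl_word as rho_check) = length as"
    if "as \<in> lists \<Delta>" "weyl_length \<Delta> (weyl_word as) = length as" for as
    using that
  proof (induction as)
    case Nil
    have "{\<beta> \<in> \<Phi>p. \<beta> \<bullet> rho_check < 0} = {}"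
      using rho_check_positive by (force simp: inner_commute)
    then show ?case
      by (simp only: inversions_def weyl_word_Nil id_apply card.empty list.size)
  next
    case (Cons a as)
    have a: "a \<in> \<Delta>" and as: "as \<in> lists \<Delta>"
      using Cons by auto
    let ?w = "weyl_word as"
    have w: "?w \<in> weyl \<Delta>"
      using as by (auto simp: weyl_def)
    have "length as \<le> weyl_length \<Delta> ?w"
    proof -
      obtain bs where bs: "bs \<in> lists \<Delta>" "length bs = weyl_length \<Delta> ?w" "weyl_word bs = ?w"
        using w by (rule weyl_length_word)
      then have "weyl_word (a # bs) = weyl_word (a # as)"
        by (simp only: weyl_word_Cons)
      then show ?thesis
        using Cons.prems a bs weyl_length_le[of "a # bs"] by simp
    qed
    then have IH: "inversions (?w rho_check) = length as"
      using Cons.IH as weyl_length_le[OF as] by simp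
    have "\<not> a \<bullet> ?w rho_check < 0"
    proof
      assume "a \<bullet> ?w rho_check < 0"
      then obtain bs where bs: "bs \<in> lists \<Delta>" "length as = Suc (length bs)"
        "weyl_word (a # as) = weyl_word bs"
        using exchange[OF as simple_positive[OF a]] unfolding weyl_word_Cons by blast
      then show False
        using Cons.prems weyl_length_le[OF bs(1)] by simp
    qed
    moreover have "a \<bullet> ?w rho_check \<noteq> 0"
      using rho_check_regular[OF weyl_root[OF weyl_inv[OF w] simple_is_root[OF a]]]
      by (simp add: weyl_inner_inv[OF w])
    ultimately have "sgn (a \<bullet> ?w rho_check) = 1"
      by simp
    then show ?case
      using inversions_simple_reflection[OF a, of "?w rho_check"] IH by (simp add: weyl_word_Cons)
  qed
  obtain as where "as \<in> lists \<Delta>" "length as = weyl_length \<Delta> w" "weyl_word as = w"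
    using assms by (rule weyl_length_word)
  then show ?thesis
    using reduced[of as] by simp
qed

lemma weyl_length_reflection_less:
  assumes w: "w \<in> weyl \<Delta>" and \<gamma>: "\<gamma> \<in> \<Phi>p" and neg: "- w \<gamma> \<in> \<Phi>p"
  shows "weyl_length \<Delta> (w \<circ> root_reflection \<gamma>) < weyl_length \<Delta> w"
proof -
  obtain as where as: "as \<in> lists \<Delta>" "length as = weyl_length \<Delta> w" "weyl_word as = w"
    using w by (rule weyl_length_word)
  have "- w \<gamma> \<bullet> weyl_word as rho_check < 0"
    using rho_check_positive[OF \<gamma>] as by (simp add: weyl_inner[OF w] inner_commute)
  then obtain bs where "bs \<in> lists \<Delta>" "length as = Suc (length bs)"
    "root_reflection (- w \<gamma>) \<circ> w = weyl_word bs"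
    using exchange[OF as(1) neg] as(3) by blast
  then show ?thesis
    using as weyl_length_le[of bs]
    by (simp add: weyl_conjugates_reflection[OF w] root_reflection_uminus)
qed

lemma weyl_positive_imp_id:
  assumes v: "v \<in> weyl \<Delta>" and pos: "\<And>\<alpha>. \<alpha> \<in> \<Phi>p \<Longrightarrow> v \<alpha> \<in> \<Phi>p"
  shows "v = id"
proof -
  have "\<not> \<beta> \<bullet> v rho_check < 0" if "\<beta> \<in> \<Phi>p" for \<beta>
  proof
    assume "\<beta> \<bullet> v rho_check < 0"
    then have "rho_check \<bullet> (- inv v \<beta>) > 0"
      by (simp add: weyl_inner_inv[OF v] inner_commute)
    then have "- inv v \<beta> \<in> \<Phi>p"
      using weyl_root[OF weyl_inv[OF v] positive_is_root[OF that]] minus_root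
      unfolding positive_iff_height by blast
    from pos[OF this] have "- \<beta> \<in> \<Phi>p"
      by (simp add: weyl_minus[OF v] weyl_inv_apply[OF v])
    then show False
      using that not_positive_and_negative by blast
  qed
  then have "{\<beta> \<in> \<Phi>p. \<beta> \<bullet> v rho_check < 0} = {}"
    by blast
  then have "weyl_length \<Delta> v = 0"
    by (simp only: weyl_length_inversions[OF v] inversions_def card.empty)
  then show ?thesis
    using weyl_length_word[OF v] weyl_word_Nil by (metis length_0_conv)
qed

end

locale dominant_weight = based_root_system \<Phi> \<Delta>
  for \<Phi> \<Delta> :: "'a::euclidean_space set" +
  fixes \<Lambda> :: 'a
  assumes weight: "\<Lambda> \<in> weight_lattice \<Phi>" and dominant: "dominant \<Delta> \<Lambda>"
begin

abbreviation "J \<equiv> stabilizer_nodes \<Delta> \<Lambda>"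

lemma stabilizer_nodes_subset: "J \<subseteq> \<Delta>"
  by (auto simp: stabilizer_nodes_def)

lemma weyl_stabilizer: "v \<in> weyl J \<Longrightarrow> v \<in> weyl \<Delta>"
  using weyl_mono[OF stabilizer_nodes_subset] by blast

lemma stabilizer_fixes: "v \<in> weyl J \<Longrightarrow> v \<Lambda> = \<Lambda>"
  by (induction rule: weyl_induct) (simp_all add: stabilizer_nodes_def root_reflection_def)

lemma simple_inner_dominant:
  assumes "a \<in> \<Delta>"
  shows "a \<bullet> \<Lambda> \<ge> 0" "a \<in> J \<longleftrightarrow> a \<bullet> \<Lambda> = 0"
  using assms dominant coroot_inner_pos_iff[OF root_nonzero[OF simple_is_root[OF assms]], of \<Lambda>]
  by (auto simp: dominant_def stabilizer_nodes_def not_less[symmetric])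

lemma positive_inner_dominant:
  assumes "\<alpha> \<in> \<Phi>p"
  shows "\<alpha> \<bullet> \<Lambda> \<ge> 0"
proof -
  have "coweight b \<bullet> \<alpha> \<ge> 0" if "b \<in> \<Delta>" for b
    using that assms positive_iff by blast
  then show ?thesis
    by (subst inner_simple_expansion) (simp add: sum_nonneg simple_inner_dominant)
qed

lemma orthogonal_support:
  assumes "\<alpha> \<in> \<Phi>p" "\<alpha> \<bullet> \<Lambda> = 0" "b \<in> \<Delta>" "coweight b \<bullet> \<alpha> \<noteq> 0"
  shows "b \<in> J"
proof -
  have "coweight b \<bullet> \<alpha> \<ge> 0" if "b \<in> \<Delta>" for b
    using that assms positive_iff by blast
  moreover have "(\<Sum>b\<in>\<Delta>. (coweight b \<bullet> \<alpha>) * (b \<bullet> \<Lambda>)) = 0"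
    using assms(2) by (subst inner_simple_expansion[symmetric])
  ultimately have "(coweight b \<bullet> \<alpha>) * (b \<bullet> \<Lambda>) = 0"
    using sum_nonneg_eq_0_iff[OF finite_simple, of "\<lambda>b. (coweight b \<bullet> \<alpha>) * (b \<bullet> \<Lambda>)"]
      simple_inner_dominant(1) assms(3) by simp
  then show ?thesis
    using assms simple_inner_dominant(2) by auto
qed

lemma parabolic_positive_iff:
  "\<alpha> \<in> parabolic_positive_roots \<Phi> \<Delta> J \<longleftrightarrow> \<alpha> \<in> \<Phi>p \<and> \<alpha> \<bullet> \<Lambda> = 0"
proof
  assume "\<alpha> \<in> parabolic_positive_roots \<Phi> \<Delta> J"
  then obtain v b where v: "v \<in> weyl J" "b \<in> J" "\<alpha> = v b" and pos: "\<alpha> \<in> \<Phi>p"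
    by (auto simp: parabolic_positive_roots_def parabolic_roots_def)
  have "\<alpha> \<bullet> \<Lambda> = v b \<bullet> v \<Lambda>"
    using v by (simp add: stabilizer_fixes)
  also have "\<dots> = b \<bullet> \<Lambda>"
    by (rule weyl_inner[OF v(1)])
  finally show "\<alpha> \<in> \<Phi>p \<and> \<alpha> \<bullet> \<Lambda> = 0"
    using pos v(2) simple_inner_dominant(2) stabilizer_nodes_subset by auto
next
  assume *: "\<alpha> \<in> \<Phi>p \<and> \<alpha> \<bullet> \<Lambda> = 0"
  then have "\<alpha> \<in> \<Phi>p"
    by simp
  then have "\<alpha> \<bullet> \<Lambda> = 0 \<longrightarrow> \<alpha> \<in> parabolic_roots J"
  proof (induction rule: positive_root_induct)
    case (simple a)
    show ?case
    proof
      assume "a \<bullet> \<Lambda> = 0"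
      then have "a = id a \<and> id \<in> weyl J \<and> a \<in> J"
        using simple simple_inner_dominant(2) weyl_id by auto
      then show "a \<in> parabolic_roots J"
        unfolding parabolic_roots_def by blast
    qed
  next
    case (reflect \<alpha> a)
    show ?case
    proof
      assume orth: "\<alpha> \<bullet> \<Lambda> = 0"
      then have a: "a \<in> J"
        using orthogonal_support[of \<alpha> a] reflect by auto
      then have "root_reflection a \<Lambda> = \<Lambda>"
        by (simp add: stabilizer_nodes_def root_reflection_def)
      then have "root_reflection a \<alpha> \<bullet> \<Lambda> = 0"
        using orth by (simp add: root_reflection_swap)
      then obtain v b where v: "v \<in> weyl J" "b \<in> J" "root_reflection a \<alpha> = v b"
        using reflect.IH by (auto simp: parabolic_roots_def)
      then have "\<alpha> = (root_reflection a \<circ> v) b"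
        by (metis comp_apply root_reflection_involution)
      then show "\<alpha> \<in> parabolic_roots J"
        using v a weyl_comp[OF weyl_simple_reflection[OF a] v(1)] unfolding parabolic_roots_def by blast
    qed
  qed
  with * show "\<alpha> \<in> parabolic_positive_roots \<Phi> \<Delta> J"
    by (simp add: parabolic_positive_roots_def)
qed

lemma nonparabolic_positive_iff:
  "\<alpha> \<in> \<Phi>p - parabolic_positive_roots \<Phi> \<Delta> J \<longleftrightarrow> \<alpha> \<in> \<Phi> \<and> \<alpha> \<bullet> \<Lambda> > 0"
proof
  assume "\<alpha> \<in> \<Phi>p - parabolic_positive_roots \<Phi> \<Delta> J"
  then show "\<alpha> \<in> \<Phi> \<and> \<alpha> \<bullet> \<Lambda> > 0"
    using positive_inner_dominant[of \<alpha>] positive_is_root[of \<alpha>]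
    by (auto simp: parabolic_positive_iff less_le)
next
  assume "\<alpha> \<in> \<Phi> \<and> \<alpha> \<bullet> \<Lambda> > 0"
  then show "\<alpha> \<in> \<Phi>p - parabolic_positive_roots \<Phi> \<Delta> J"
    using positive_inner_dominant[of "- \<alpha>"] positive_or_negative[of \<alpha>]
    by (auto simp: parabolic_positive_iff)
qed

lemma positive_sum_dominant:
  "positive_sum \<Lambda> = 2 *\<^sub>R rho \<Phi> \<Delta> - 2 *\<^sub>R rho_parabolic \<Phi> \<Delta> J"
proof -
  let ?P = "parabolic_positive_roots \<Phi> \<Delta> J"
  have "{\<beta> \<in> \<Phi>. \<beta> \<bullet> \<Lambda> > 0} = \<Phi>p - ?P"
    using nonparabolic_positive_iff by blast
  then have "positive_sum \<Lambda> = \<Sum>(\<Phi>p - ?P)"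
    by (simp add: positive_sum_def)
  also have "\<dots> = \<Sum>\<Phi>p - \<Sum>?P"
    using finite_positive by (rule sum_diff) (auto simp: parabolic_positive_iff)
  finally show ?thesis
    by (simp add: rho_def rho_parabolic_def)
qed

lemma min_rep_weyl: "w \<in> min_reps \<Delta> J \<Longrightarrow> w \<in> weyl \<Delta>"
  by (simp add: min_reps_def)

text \<open>For \<open>\<alpha>\<close> in \<open>J\<close> this is minimality of \<open>w\<close> against the reflection in \<open>\<alpha>\<close>; in general \<open>\<alpha>\<close> is a
  nonnegative combination of \<open>J\<close>.\<close>

lemma min_rep_positive:
  assumes w: "w \<in> min_reps \<Delta> J" and \<alpha>: "\<alpha> \<in> \<Phi>p" "\<alpha> \<bullet> \<Lambda> = 0"
  shows "w \<alpha> \<in> \<Phi>p"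
proof -
  have W: "w \<in> weyl \<Delta>"
    using w by (rule min_rep_weyl)
  have simple: "w b \<in> \<Phi>p" if b: "b \<in> J" for b
  proof (rule ccontr)
    assume "w b \<notin> \<Phi>p"
    have b': "b \<in> \<Delta>"
      using b stabilizer_nodes_subset by blast
    then have "- w b \<in> \<Phi>p"
      using \<open>w b \<notin> \<Phi>p\<close> weyl_root[OF W simple_is_root] positive_or_negative by blast
    then have "weyl_length \<Delta> (w \<circ> root_reflection b) < weyl_length \<Delta> w"
      using weyl_length_reflection_less[OF W simple_positive] b' by blast
    moreover have "weyl_length \<Delta> w \<le> weyl_length \<Delta> (w \<circ> root_reflection b)"
      using w weyl_simple_reflection[OF b] unfolding min_reps_def by blast
    ultimately show False
      by simp
  qed
  have "w \<alpha> = w (\<Sum>b\<in>\<Delta>. (coweight b \<bullet> \<alpha>) *\<^sub>R b)"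
    by (simp only: simple_expansion[symmetric])
  also have "\<dots> = (\<Sum>b\<in>\<Delta>. (coweight b \<bullet> \<alpha>) *\<^sub>R w b)"
    using weyl_linear[OF W] by (simp add: linear_sum linear_cmul)
  finally have "rho_check \<bullet> w \<alpha> = (\<Sum>b\<in>\<Delta>. (coweight b \<bullet> \<alpha>) * (rho_check \<bullet> w b))"
    by (simp add: inner_sum_right)
  moreover have "(coweight b \<bullet> \<alpha>) * (rho_check \<bullet> w b) \<ge> 0" if "b \<in> \<Delta>" for b
  proof (cases "b \<in> J")
    case True
    have "coweight b \<bullet> \<alpha> \<ge> 0"
      using that \<alpha>(1) positive_iff by blast
    then show ?thesis
      using rho_check_positive[OF simple[OF True]] by simp
  next
    case False
    then show ?thesis
      using orthogonal_support[OF \<alpha> that] by (cases "coweight b \<bullet> \<alpha> = 0") auto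
  qed
  ultimately have "rho_check \<bullet> w \<alpha> \<ge> 0"
    by (simp add: sum_nonneg)
  moreover have "w \<alpha> \<in> \<Phi>"
    using W \<alpha> weyl_root positive_is_root by blast
  ultimately show ?thesis
    using rho_check_regular[of "w \<alpha>"] by (auto simp: positive_iff_height inner_commute less_le)
qed

text \<open>The quotient \<open>v\<close> of \<open>w\<close> and \<open>w'\<close> fixes \<open>\<Lambda>\<close>, so it preserves the sign of the roots that are not
  orthogonal to \<open>\<Lambda>\<close>. On the orthogonal ones it preserves the sign because \<open>w\<close> and \<open>w v\<close> do. An element
  that keeps all positive roots positive is the identity.\<close>

lemma min_reps_unique:
  assumes w: "w \<in> min_reps \<Delta> J" and w': "w' \<in> min_reps \<Delta> J" and eq: "w \<Lambda> = w' \<Lambda>"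
  shows "w = w'"
proof -
  note W = min_rep_weyl[OF w] and W' = min_rep_weyl[OF w']
  define v where "v = inv w \<circ> w'"
  have v: "v \<in> weyl \<Delta>"
    unfolding v_def by (rule weyl_comp[OF weyl_inv[OF W] W'])
  have wv: "w (v x) = w' x" for x
    by (simp add: v_def weyl_inv_apply[OF W])
  have fix\<Lambda>: "v \<Lambda> = \<Lambda>"
    by (simp add: v_def eq[symmetric] weyl_inv_apply[OF W])
  have "v \<alpha> \<in> \<Phi>p" if \<alpha>: "\<alpha> \<in> \<Phi>p" for \<alpha>
  proof (rule ccontr)
    assume "v \<alpha> \<notin> \<Phi>p"
    then have neg: "- v \<alpha> \<in> \<Phi>p"
      using weyl_root[OF v positive_is_root[OF \<alpha>]] positive_or_negative by blast
    have "v \<alpha> \<bullet> \<Lambda> = \<alpha> \<bullet> \<Lambda>"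
      using weyl_inner[OF v, of \<alpha> \<Lambda>] fix\<Lambda> by simp
    then have zero: "\<alpha> \<bullet> \<Lambda> = 0" "- v \<alpha> \<bullet> \<Lambda> = 0"
      using positive_inner_dominant[OF \<alpha>] positive_inner_dominant[OF neg] by simp_all
    have "w (- v \<alpha>) \<in> \<Phi>p"
      using min_rep_positive[OF w neg zero(2)] .
    then have "- w' \<alpha> \<in> \<Phi>p"
      by (simp add: weyl_minus[OF W] wv)
    then show False
      using min_rep_positive[OF w' \<alpha> zero(1)] not_positive_and_negative by blast
  qed
  then have "v = id"
    using v weyl_positive_imp_id by blast
  then show ?thesis
    using wv by (auto simp: fun_eq_iff)
qed

lemma min_reps_translate:
  assumes w: "w \<in> min_reps \<Delta> J" and v: "v \<in> weyl J"
    and le: "weyl_length \<Delta> (w \<circ> v) \<le> weyl_length \<Delta> w"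
  shows "v = id"
proof -
  have "w \<circ> v \<in> min_reps \<Delta> J"
    unfolding min_reps_def
  proof (intro CollectI conjI ballI)
    show "w \<circ> v \<in> weyl \<Delta>"
      using weyl_comp min_rep_weyl[OF w] weyl_stabilizer[OF v] by blast
    fix u assume "u \<in> weyl J"
    then have "weyl_length \<Delta> w \<le> weyl_length \<Delta> (w \<circ> (v \<circ> u))"
      using w weyl_comp[OF v] unfolding min_reps_def by blast
    then show "weyl_length \<Delta> (w \<circ> v) \<le> weyl_length \<Delta> (w \<circ> v \<circ> u)"
      using le by (simp add: comp_assoc)
  qed
  then have "w \<circ> v = w"
    using w stabilizer_fixes[OF v] by (intro min_reps_unique) auto
  then have "w (v x) = w x" for x
    by (metis comp_apply)
  then have "v x = x" for x
    using weyl_inv_apply(2)[OF min_rep_weyl[OF w]] by metis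
  then show ?thesis
    by auto
qed

lemma exists_min_rep:
  assumes "x \<in> weyl \<Delta>"
  obtains v where "v \<in> weyl J" "x \<circ> v \<in> min_reps \<Delta> J"
proof -
  obtain v where v: "v \<in> weyl J"
    "\<And>u. u \<in> weyl J \<Longrightarrow> weyl_length \<Delta> (x \<circ> v) \<le> weyl_length \<Delta> (x \<circ> u)"
    using ex_has_least_nat[of "\<lambda>v. v \<in> weyl J" id "\<lambda>v. weyl_length \<Delta> (x \<circ> v)"] weyl_id by blast
  have "x \<circ> v \<in> weyl \<Delta>"
    using assms v(1) weyl_comp weyl_stabilizer by blast
  moreover have "weyl_length \<Delta> (x \<circ> v) \<le> weyl_length \<Delta> (x \<circ> v \<circ> u)" if "u \<in> weyl J" for u
    using v(2)[OF weyl_comp[OF v(1) that]] by (simp add: comp_assoc)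
  ultimately have "x \<circ> v \<in> min_reps \<Delta> J"
    by (simp add: min_reps_def)
  with v(1) show ?thesis
    by (rule that)
qed

lemma min_rep_works:
  assumes x: "x \<in> weyl \<Delta>"
  shows "min_rep \<Delta> J x \<in> min_reps \<Delta> J" "\<exists>v\<in>weyl J. min_rep \<Delta> J x = x \<circ> v"
    "min_rep \<Delta> J x \<Lambda> = x \<Lambda>"
proof -
  obtain v where v: "v \<in> weyl J" "x \<circ> v \<in> min_reps \<Delta> J"
    using x by (rule exists_min_rep)
  have "min_rep \<Delta> J x = x \<circ> v"
    unfolding min_rep_def
  proof (rule the_equality)
    fix y assume "y \<in> min_reps \<Delta> J \<and> (\<exists>v\<in>weyl J. y = x \<circ> v)"
    then show "y = x \<circ> v"
      using v by (intro min_reps_unique) (auto simp: stabilizer_fixes)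
  qed (use v in blast)
  with v show "min_rep \<Delta> J x \<in> min_reps \<Delta> J" "\<exists>v\<in>weyl J. min_rep \<Delta> J x = x \<circ> v"
    "min_rep \<Delta> J x \<Lambda> = x \<Lambda>"
    by (auto simp: stabilizer_fixes)
qed

text \<open>A minimal representative keeps the positive roots orthogonal to \<open>\<Lambda>\<close> positive, so that all
  its inversions come from roots not orthogonal to \<open>\<Lambda>\<close>.\<close>

lemma min_rep_length:
  assumes w: "w \<in> min_reps \<Delta> J"
  shows "weyl_length \<Delta> w = inversions (w \<Lambda>)"
proof -
  note W = min_rep_weyl[OF w]
  have "\<beta> \<bullet> w rho_check < 0 \<longleftrightarrow> \<beta> \<bullet> w \<Lambda> < 0" if \<beta>: "\<beta> \<in> \<Phi>p" for \<beta>
  proof -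
    define \<alpha> where "\<alpha> = inv w \<beta>"
    have \<alpha>: "\<alpha> \<in> \<Phi>" "w \<alpha> = \<beta>"
      using weyl_root[OF weyl_inv[OF W]] \<beta> positive_is_root by (auto simp: \<alpha>_def weyl_inv_apply[OF W])
    have "\<alpha> \<bullet> rho_check < 0 \<longleftrightarrow> \<alpha> \<bullet> \<Lambda> < 0"
    proof
      assume "\<alpha> \<bullet> rho_check < 0"
      then have neg: "- \<alpha> \<in> \<Phi>p"
        using minus_root[OF \<alpha>(1)] by (simp add: positive_iff_height inner_commute)
      then have "- \<alpha> \<bullet> \<Lambda> \<noteq> 0"
        using min_rep_positive[OF w neg] not_positive_and_negative[OF \<beta>]
        by (auto simp: weyl_minus[OF W] \<alpha>)
      then show "\<alpha> \<bullet> \<Lambda> < 0"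
        using positive_inner_dominant[OF neg] by simp
    next
      assume "\<alpha> \<bullet> \<Lambda> < 0"
      then show "\<alpha> \<bullet> rho_check < 0"
        using positive_inner_dominant[of \<alpha>] rho_check_regular[OF \<alpha>(1)] \<alpha>(1)
        by (cases "\<alpha> \<bullet> rho_check > 0") (auto simp: positive_iff_height inner_commute)
    qed
    then show ?thesis
      by (simp add: weyl_inner_inv[OF W] \<alpha>_def)
  qed
  then show ?thesis
    unfolding weyl_length_inversions[OF W] inversions_def
    by (intro arg_cong[of _ _ card]) blast
qed

lemma min_rep_length_le:
  assumes "x \<in> weyl \<Delta>"
  shows "weyl_length \<Delta> (min_rep \<Delta> J x) \<le> weyl_length \<Delta> x"
proof -
  obtain v where v: "v \<in> weyl J" "min_rep \<Delta> J x = x \<circ> v"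
    using min_rep_works(2)[OF assms] by blast
  have "weyl_length \<Delta> (x \<circ> v) \<le> weyl_length \<Delta> (x \<circ> v \<circ> inv v)"
    using min_rep_works(1)[OF assms] weyl_inv[OF v(1)] unfolding v(2) min_reps_def by blast
  moreover have "x \<circ> v \<circ> inv v = x"
    using weyl_inv_apply(1)[OF v(1)] by (simp add: fun_eq_iff)
  ultimately show ?thesis
    by (simp add: v(2))
qed

text \<open>Let \<open>u = w r\<^sub>\<gamma> v\<close> be the minimal representative of the coset of \<open>w r\<^sub>\<gamma>\<close>. Reflecting back gives
  \<open>w v\<close>, which is shorter than \<open>u\<close> and hence not longer than \<open>w\<close>; by minimality of \<open>w\<close> this forces
  \<open>v = 1\<close>.\<close>

lemma min_rep_reflection_length:
  assumes w: "w \<in> min_reps \<Delta> J" and \<gamma>: "\<gamma> \<in> \<Phi>" "\<gamma> \<bullet> \<Lambda> > 0" and pos: "w \<gamma> \<in> \<Phi>p"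
    and length: "inversions (w (root_reflection \<gamma> \<Lambda>)) = inversions (w \<Lambda>) + 1"
  shows "weyl_length \<Delta> (w \<circ> root_reflection \<gamma>) = weyl_length \<Delta> w + 1"
proof -
  note W = min_rep_weyl[OF w]
  let ?x = "w \<circ> root_reflection \<gamma>"
  have x: "?x \<in> weyl \<Delta>"
    using weyl_comp[OF W reflection_in_weyl[OF \<gamma>(1)]] .
  define u where "u = min_rep \<Delta> J ?x"
  have u: "u \<in> min_reps \<Delta> J" "u \<Lambda> = ?x \<Lambda>"
    using min_rep_works[OF x] by (simp_all add: u_def)
  obtain v where v: "v \<in> weyl J" "u = ?x \<circ> v"
    using min_rep_works(2)[OF x] by (auto simp: u_def)
  note V = weyl_stabilizer[OF v(1)]
  have length_u: "weyl_length \<Delta> u = weyl_length \<Delta> w + 1"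
    using length u(2) min_rep_length[OF u(1)] min_rep_length[OF w] by simp
  define \<gamma>' where "\<gamma>' = inv v \<gamma>"
  have "\<gamma>' \<bullet> \<Lambda> = \<gamma> \<bullet> \<Lambda>"
    using weyl_inner_inv[OF V, of \<gamma> \<Lambda>] stabilizer_fixes[OF v(1)] by (simp add: \<gamma>'_def)
  then have \<gamma>': "\<gamma>' \<in> \<Phi>p"
    using \<gamma> weyl_root[OF weyl_inv[OF V] \<gamma>(1)] nonparabolic_positive_iff[of \<gamma>'] by (simp add: \<gamma>'_def)
  have u\<gamma>': "u \<gamma>' = - w \<gamma>"
    by (simp add: v(2) \<gamma>'_def weyl_inv_apply[OF V] root_reflection_self weyl_minus[OF W])
  have "u \<circ> root_reflection \<gamma>' = root_reflection (w \<gamma>) \<circ> u"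
    using weyl_conjugates_reflection[OF min_rep_weyl[OF u(1)], of \<gamma>'] by (simp only: u\<gamma>' root_reflection_uminus)
  also have "\<dots> = w \<circ> v"
    unfolding v(2) weyl_conjugates_reflection[OF W] by (simp add: fun_eq_iff)
  finally have "weyl_length \<Delta> (w \<circ> v) < weyl_length \<Delta> u"
    using weyl_length_reflection_less[OF min_rep_weyl[OF u(1)] \<gamma>'] pos u\<gamma>' by simp
  then have "v = id"
    using length_u by (intro min_reps_translate[OF w v(1)]) simp
  then show ?thesis
    using length_u by (simp only: v(2) comp_id)
qed


section \<open>The orbit of the level-zero weight\<close>

lemma orbit_iff:
  "\<mu> \<in> level_zero_orbit \<Phi> \<Delta> \<Lambda> \<longleftrightarrow>
     (\<exists>w\<in>weyl \<Delta>. \<exists>\<tau>\<in>coroot_lattice \<Phi>. \<mu> = (w \<Lambda>, - (\<tau> \<bullet> \<Lambda>)))"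
proof
  assume "\<mu> \<in> level_zero_orbit \<Phi> \<Delta> \<Lambda>"
  then show "\<exists>w\<in>weyl \<Delta>. \<exists>\<tau>\<in>coroot_lattice \<Phi>. \<mu> = (w \<Lambda>, - (\<tau> \<bullet> \<Lambda>))"
    by (auto simp: level_zero_orbit_def affine_weyl_def of_finite_def)
next
  assume "\<exists>w\<in>weyl \<Delta>. \<exists>\<tau>\<in>coroot_lattice \<Phi>. \<mu> = (w \<Lambda>, - (\<tau> \<bullet> \<Lambda>))"
  then obtain w \<tau> where w: "w \<in> weyl \<Delta>" "\<tau> \<in> coroot_lattice \<Phi>" "\<mu> = (w \<Lambda>, - (\<tau> \<bullet> \<Lambda>))"
    by blast
  let ?g = "\<lambda>(\<eta>, k). (w \<eta>, k - \<tau> \<bullet> \<eta>)"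
  have "?g \<in> affine_weyl \<Phi> \<Delta>" "\<mu> = ?g (of_finite \<Lambda>)"
    using w by (auto simp: affine_weyl_def of_finite_def)
  then show "\<mu> \<in> level_zero_orbit \<Phi> \<Delta> \<Lambda>"
    unfolding level_zero_orbit_def by blast
qed

lemma coroot_lattice_add:
  assumes "\<tau> \<in> coroot_lattice \<Phi>" "\<alpha> \<in> \<Phi>"
  shows "\<tau> + real_of_int n *\<^sub>R coroot \<alpha> \<in> coroot_lattice \<Phi>"
proof -
  obtain c :: "'a \<Rightarrow> int" where c: "\<tau> = (\<Sum>\<alpha>\<in>\<Phi>. real_of_int (c \<alpha>) *\<^sub>R coroot \<alpha>)"
    using assms(1) by (auto simp: coroot_lattice_def)
  have "(\<Sum>\<beta>\<in>\<Phi>. real_of_int (c \<beta> + (if \<beta> = \<alpha> then n else 0)) *\<^sub>R coroot \<beta>)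
      = \<tau> + (\<Sum>\<beta>\<in>\<Phi>. if \<beta> = \<alpha> then real_of_int n *\<^sub>R coroot \<alpha> else 0)"
    unfolding c sum.distrib[symmetric] by (rule sum.cong) (auto simp: scaleR_left_distrib)
  also have "\<dots> = \<tau> + real_of_int n *\<^sub>R coroot \<alpha>"
    using assms(2) finite_roots by simp
  finally show ?thesis
    unfolding coroot_lattice_def by (intro CollectI exI[of _ "\<lambda>\<beta>. c \<beta> + (if \<beta> = \<alpha> then n else 0)"]) simp
qed

lemma orbit_reflection:
  assumes \<mu>: "\<mu> \<in> level_zero_orbit \<Phi> \<Delta> \<Lambda>" and \<beta>: "fst \<beta> \<in> \<Phi>" "snd \<beta> \<in> \<int>"
  shows "affine_reflection \<beta> \<mu> \<in> level_zero_orbit \<Phi> \<Delta> \<Lambda>"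
proof -
  obtain w \<tau> where w: "w \<in> weyl \<Delta>" and \<tau>: "\<tau> \<in> coroot_lattice \<Phi>" and \<mu>_eq: "\<mu> = (w \<Lambda>, - (\<tau> \<bullet> \<Lambda>))"
    using \<mu> by (auto simp: orbit_iff)
  obtain n :: int where n: "snd \<beta> = n"
    using \<beta>(2) by (elim Ints_cases)
  define \<gamma> where "\<gamma> = inv w (fst \<beta>)"
  have \<gamma>: "\<gamma> \<in> \<Phi>"
    unfolding \<gamma>_def using weyl_root[OF weyl_inv[OF w] \<beta>(1)] .
  have "coroot (fst \<beta>) \<bullet> w \<Lambda> = coroot \<gamma> \<bullet> \<Lambda>"
    by (simp add: \<gamma>_def weyl_inner_inv[OF w] orthogonal_coroot[OF weyl_orthogonal[OF weyl_inv[OF w]]])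
  then have "affine_reflection \<beta> \<mu> =
      ((root_reflection (fst \<beta>) \<circ> w) \<Lambda>, - ((\<tau> + real_of_int n *\<^sub>R coroot \<gamma>) \<bullet> \<Lambda>))"
    by (simp add: affine_reflection_pair \<mu>_eq n inner_add_left)
  moreover have "root_reflection (fst \<beta>) \<circ> w \<in> weyl \<Delta>"
    using weyl_comp[OF reflection_in_weyl[OF \<beta>(1)] w] .
  moreover have "\<tau> + real_of_int n *\<^sub>R coroot \<gamma> \<in> coroot_lattice \<Phi>"
    using \<tau> \<gamma> by (rule coroot_lattice_add)
  ultimately show ?thesis
    unfolding orbit_iff by blast
qed

lemma orbit_level_integral:
  assumes "\<mu> \<in> level_zero_orbit \<Phi> \<Delta> \<Lambda>"
  shows "snd \<mu> \<in> \<int>"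
proof -
  obtain c :: "'a \<Rightarrow> int" where "snd \<mu> = - ((\<Sum>\<alpha>\<in>\<Phi>. real_of_int (c \<alpha>) *\<^sub>R coroot \<alpha>) \<bullet> \<Lambda>)"
    using assms by (auto simp: orbit_iff coroot_lattice_def)
  then show ?thesis
    using weight by (auto simp: weight_lattice_def inner_sum_left intro!: Ints_sum Ints_mult)
qed

lemma cl_eq:
  assumes "w \<in> min_reps \<Delta> J" "fst \<mu> = w \<Lambda>" "snd \<mu> \<in> \<int>"
  shows "cl \<Delta> \<Lambda> \<mu> = w"
  unfolding cl_def
proof (rule the_equality)
  obtain k :: int where "snd \<mu> = k"
    using assms(3) by (elim Ints_cases)
  then show "w \<in> min_reps \<Delta> J \<and> (\<exists>k. \<mu> = of_finite (w \<Lambda>) + real_of_int k *\<^sub>R \<delta>)"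
    using assms by (auto simp: of_finite_def \<delta>_def prod_eq_iff)
  fix x assume "x \<in> min_reps \<Delta> J \<and> (\<exists>k. \<mu> = of_finite (x \<Lambda>) + real_of_int k *\<^sub>R \<delta>)"
  then show "x = w"
    using assms by (intro min_reps_unique) (auto simp: of_finite_def \<delta>_def)
qed

lemma cl_orbit:
  assumes "\<mu> \<in> level_zero_orbit \<Phi> \<Delta> \<Lambda>"
  shows "cl \<Delta> \<Lambda> \<mu> \<in> min_reps \<Delta> J" "fst \<mu> = cl \<Delta> \<Lambda> \<mu> \<Lambda>"
proof -
  obtain x where x: "x \<in> weyl \<Delta>" "fst \<mu> = x \<Lambda>"
    using assms by (auto simp: orbit_iff)
  then have "cl \<Delta> \<Lambda> \<mu> = min_rep \<Delta> J x"
    using min_rep_works[OF x(1)] orbit_level_integral[OF assms] by (intro cl_eq) auto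
  then show "cl \<Delta> \<Lambda> \<mu> \<in> min_reps \<Delta> J" "fst \<mu> = cl \<Delta> \<Lambda> \<mu> \<Lambda>"
    using min_rep_works[OF x(1)] x(2) by auto
qed

end


section \<open>Covers in the level-zero weight poset\<close>

locale level_zero_poset = highest_root_system \<Phi> \<Delta> \<theta> + dominant_weight \<Phi> \<Delta> \<Lambda>
  for \<Phi> \<Delta> :: "'a::euclidean_space set" and \<theta> \<Lambda> :: 'a
begin

abbreviation "orbit \<equiv> level_zero_orbit \<Phi> \<Delta> \<Lambda>"
abbreviation "step \<equiv> level_zero_step \<Phi> \<Delta> \<Lambda>"
abbreviation "below \<equiv> level_zero_less \<Phi> \<Delta> \<Lambda>"
abbreviation "covers \<equiv> level_zero_covers \<Phi> \<Delta> \<Lambda>"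

lemma below_trans: "below x y \<Longrightarrow> below y z \<Longrightarrow> below x z"
  and below_le_trans: "below x y \<Longrightarrow> step\<^sup>*\<^sup>* y z \<Longrightarrow> below x z"
  and le_below_trans: "step\<^sup>*\<^sup>* x y \<Longrightarrow> below y z \<Longrightarrow> below x z"
  and below_imp_le: "below x y \<Longrightarrow> step\<^sup>*\<^sup>* x y"
  and step_imp_below: "step x y \<Longrightarrow> below x y"
  unfolding level_zero_less_def by (auto intro: tranclp_into_rtranclp)

lemma orbit_affine_reflection:
  "\<mu> \<in> orbit \<Longrightarrow> \<beta> \<in> affine_positive \<Longrightarrow> affine_reflection \<beta> \<mu> \<in> orbit"
  by (rule orbit_reflection) (auto simp: affine_positive_iff)

lemma stepI:
  "\<mu> \<in> orbit \<Longrightarrow> \<beta> \<in> affine_positive \<Longrightarrow> affine_pairing \<beta> \<mu> > 0 \<Longrightarrow> step \<mu> (affine_reflection \<beta> \<mu>)"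
  unfolding level_zero_step_def by blast

lemma stepE:
  assumes "step \<mu> \<nu>"
  obtains \<beta> where "\<mu> \<in> orbit" "\<nu> \<in> orbit" "\<beta> \<in> affine_positive" "affine_pairing \<beta> \<mu> > 0"
    "\<nu> = affine_reflection \<beta> \<mu>"
  using assms orbit_affine_reflection unfolding level_zero_step_def by blast

lemma step_height:
  assumes "step \<mu> \<nu>"
  shows "affine_height \<nu> < affine_height \<mu>"
  using assms
proof (rule stepE)
  fix \<beta> assume "\<beta> \<in> affine_positive" "affine_pairing \<beta> \<mu> > 0" "\<nu> = affine_reflection \<beta> \<mu>"
  then show ?thesis
    using affine_height_positive[of \<beta>] by (simp add: affine_reflection_def affine_height_linear)
qed

lemma below_height: "below \<mu> \<nu> \<Longrightarrow> affine_height \<nu> < affine_height \<mu>"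
  unfolding level_zero_less_def by (induction rule: tranclp_induct) (auto dest!: step_height)

lemma below_irreflexive: "\<not> below \<mu> \<mu>"
  using below_height by blast

lemma below_orbit: "below \<mu> \<nu> \<Longrightarrow> \<mu> \<in> orbit \<and> \<nu> \<in> orbit"
  unfolding level_zero_less_def by (induction rule: tranclp_induct) (auto elim: stepE)

lemma le_imp_below: "step\<^sup>*\<^sup>* x y \<Longrightarrow> x \<noteq> y \<Longrightarrow> below x y"
  unfolding level_zero_less_def by (meson rtranclpD)

lemma affine_pairing_reflected_self:
  assumes "b \<in> affine_simple"
  shows "affine_pairing b (affine_reflection b x) = - affine_pairing b x"
  using affine_pairing_self[OF affine_root_nonzero[OF affine_simple_positive[OF assms]]]
  by (simp add: affine_pairing_reflected)

lemma affine_reflection_fixed: "affine_pairing b x = 0 \<Longrightarrow> affine_reflection b x = x"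
  by (simp add: affine_reflection_def)

lemma simple_step_up:
  "b \<in> affine_simple \<Longrightarrow> x \<in> orbit \<Longrightarrow> affine_pairing b x > 0 \<Longrightarrow> step x (affine_reflection b x)"
  using stepI affine_simple_positive by blast

lemma simple_step_down:
  assumes "b \<in> affine_simple" "x \<in> orbit" "affine_pairing b x < 0"
  shows "step (affine_reflection b x) x"
  using simple_step_up[OF assms(1) orbit_affine_reflection[OF assms(2) affine_simple_positive[OF assms(1)]]]
    assms(3) by (simp add: affine_pairing_reflected_self[OF assms(1)])

lemma step_conjugate:
  assumes "b \<in> affine_simple" "\<beta> \<in> affine_positive" "\<beta> \<noteq> b" "x \<in> orbit" "affine_pairing \<beta> x > 0"
  shows "step (affine_reflection b x) (affine_reflection b (affine_reflection \<beta> x))"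
  unfolding affine_reflection_conjugate[of b \<beta>]
  using assms affine_simple_positive
  by (intro stepI orbit_affine_reflection affine_simple_permutes) (auto simp: affine_pairing_reflections)

definition upper :: "'a \<times> real \<Rightarrow> 'a \<times> real \<Rightarrow> 'a \<times> real" where
  "upper b x = (if affine_pairing b x > 0 then affine_reflection b x else x)"

definition lower :: "'a \<times> real \<Rightarrow> 'a \<times> real \<Rightarrow> 'a \<times> real" where
  "lower b x = (if affine_pairing b x < 0 then affine_reflection b x else x)"

text \<open>The lifting property: for an affine simple root \<open>b\<close>, the larger (and the smaller) of \<open>x\<close> and
  its reflection in \<open>b\<close> depends monotonically on \<open>x\<close>.\<close>

lemma lifting_step:
  assumes b: "b \<in> affine_simple" and "step \<mu> \<nu>"
  shows "step\<^sup>*\<^sup>* (upper b \<mu>) (upper b \<nu>) \<and> step\<^sup>*\<^sup>* (lower b \<mu>) (lower b \<nu>)"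
  using assms(2)
proof (rule stepE)
  fix \<beta> assume \<beta>: "\<mu> \<in> orbit" "\<nu> \<in> orbit" "\<beta> \<in> affine_positive" "affine_pairing \<beta> \<mu> > 0"
    "\<nu> = affine_reflection \<beta> \<mu>"
  show ?thesis
  proof (cases "\<beta> = b")
    case True
    then show ?thesis
      using \<beta> by (simp add: upper_def lower_def affine_pairing_reflected_self[OF b])
  next
    case False
    let ?r = "affine_reflection b"
    have 1: "step (?r \<mu>) (?r \<nu>)"
      using step_conjugate[OF b \<beta>(3) False \<beta>(1,4)] \<beta>(5) by simp
    have 2: "step\<^sup>*\<^sup>* x (?r x)" if "affine_pairing b x \<ge> 0" "x \<in> orbit" for x
      using that simple_step_up[OF b that(2)] affine_reflection_fixed[of b x]
      by (cases "affine_pairing b x = 0") auto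
    have 3: "step\<^sup>*\<^sup>* (?r x) x" if "affine_pairing b x \<le> 0" "x \<in> orbit" for x
      using that simple_step_down[OF b that(2)] affine_reflection_fixed[of b x]
      by (cases "affine_pairing b x = 0") auto
    show ?thesis
      unfolding upper_def lower_def
      using 1 assms(2) 2[OF _ \<beta>(1)] 3[OF _ \<beta>(1)] 2[OF _ \<beta>(2)] 3[OF _ \<beta>(2)]
      by (auto simp: not_less intro: rtranclp_trans converse_rtranclp_into_rtranclp rtranclp.rtrancl_into_rtrancl)
  qed
qed

lemma lifting:
  assumes "b \<in> affine_simple" "step\<^sup>*\<^sup>* \<mu> \<nu>"
  shows "step\<^sup>*\<^sup>* (upper b \<mu>) (upper b \<nu>)" "step\<^sup>*\<^sup>* (lower b \<mu>) (lower b \<nu>)"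
  using assms(2) by (induction rule: rtranclp_induct) (use lifting_step[OF assms(1)] in \<open>auto intro: rtranclp_trans\<close>)

lemma below_reflect:
  assumes b: "b \<in> affine_simple" and below: "below \<mu> \<nu>"
    and sign: "affine_pairing b \<mu> > 0 \<and> affine_pairing b \<nu> > 0 \<or> affine_pairing b \<mu> < 0 \<and> affine_pairing b \<nu> < 0"
  shows "below (affine_reflection b \<mu>) (affine_reflection b \<nu>)"
proof (rule le_imp_below)
  show "step\<^sup>*\<^sup>* (affine_reflection b \<mu>) (affine_reflection b \<nu>)"
    using lifting[OF b below_imp_le[OF below]] sign by (auto simp: upper_def lower_def)
  show "affine_reflection b \<mu> \<noteq> affine_reflection b \<nu>"
    using below below_irreflexive by (metis affine_reflection_involution)
qed

text \<open>An element \<open>\<kappa>\<close> between \<open>\<mu>\<close> and \<open>\<nu>\<close> with positive pairing is reflected along with them. Otherwise the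
  lifting property puts \<open>r \<mu>\<close> below \<open>\<kappa>\<close>, and then \<open>\<nu>\<close> itself lies strictly between \<open>r \<mu>\<close> and \<open>r \<nu>\<close>. The
  converse is dual, with \<open>r \<mu>\<close> strictly between \<open>\<mu>\<close> and \<open>\<nu>\<close>.\<close>

lemma covers_reflect:
  assumes b: "b \<in> affine_simple"
    and sign: "affine_pairing b \<mu> > 0" "affine_pairing b \<nu> > 0"
  shows "covers (affine_reflection b \<mu>) (affine_reflection b \<nu>) \<longleftrightarrow> covers \<mu> \<nu>"
proof -
  let ?r = "affine_reflection b"
  have neg: "affine_pairing b (?r \<mu>) < 0" "affine_pairing b (?r \<nu>) < 0"
    using sign by (simp_all add: affine_pairing_reflected_self[OF b])
  have below_iff: "below (?r \<mu>) (?r \<nu>) \<longleftrightarrow> below \<mu> \<nu>"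
    using below_reflect[OF b, of \<mu> \<nu>] below_reflect[OF b, of "?r \<mu>" "?r \<nu>"] sign neg by auto
  have up: "below x (?r x)" if "x \<in> orbit" "affine_pairing b x > 0" for x
    using step_imp_below simple_step_up[OF b] that by blast
  have 1: "\<exists>\<kappa>. below (?r \<mu>) \<kappa> \<and> below \<kappa> (?r \<nu>)" if \<kappa>: "below \<mu> \<kappa>" "below \<kappa> \<nu>" for \<kappa>
  proof (cases "affine_pairing b \<kappa> > 0")
    case True
    then show ?thesis
      using below_reflect[OF b] sign \<kappa> by blast
  next
    case False
    then have "step\<^sup>*\<^sup>* (?r \<mu>) \<kappa>"
      using lifting(1)[OF b below_imp_le[OF \<kappa>(1)]] sign by (simp add: upper_def)
    then have "below (?r \<mu>) \<nu>"
      using \<kappa>(2) by (rule le_below_trans)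
    then show ?thesis
      using up[of \<nu>] sign below_orbit[OF \<kappa>(2)] by blast
  qed
  have 2: "\<exists>\<kappa>. below \<mu> \<kappa> \<and> below \<kappa> \<nu>" if \<kappa>: "below (?r \<mu>) \<kappa>" "below \<kappa> (?r \<nu>)" for \<kappa>
  proof (cases "affine_pairing b \<kappa> < 0")
    case True
    then have "below \<mu> (?r \<kappa>) \<and> below (?r \<kappa>) \<nu>"
      using below_reflect[OF b \<kappa>(1)] below_reflect[OF b \<kappa>(2)] neg by simp
    then show ?thesis ..
  next
    case False
    then have "step\<^sup>*\<^sup>* \<kappa> \<nu>"
      using lifting(2)[OF b below_imp_le[OF \<kappa>(2)]] neg by (simp add: lower_def)
    then have "below (?r \<mu>) \<nu>"
      using \<kappa>(1) below_le_trans by blast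
    moreover have "\<mu> \<in> orbit"
      using orbit_affine_reflection[OF _ affine_simple_positive[OF b], of "?r \<mu>"] below_orbit[OF \<kappa>(1)] by simp
    ultimately show ?thesis
      using up[of \<mu>] sign by blast
  qed
  show ?thesis
    using below_iff 1 2 unfolding level_zero_covers_def by blast
qed

lemma covers_reflect_iff:
  assumes b: "b \<in> affine_simple"
    and sign: "sgn (affine_pairing b \<mu>) = sgn (affine_pairing b \<nu>)" "affine_pairing b \<mu> \<noteq> 0"
  shows "covers (affine_reflection b \<mu>) (affine_reflection b \<nu>) \<longleftrightarrow> covers \<mu> \<nu>"
proof (cases "affine_pairing b \<mu> > 0")
  case True
  then have "affine_pairing b \<nu> > 0"
    using sign by (metis sgn_greater)
  with True show ?thesis
    by (rule covers_reflect[OF b])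
next
  case False
  then have "affine_pairing b \<mu> < 0"
    using sign(2) by simp
  moreover from this have "affine_pairing b \<nu> < 0"
    using sign(1) by (metis sgn_less)
  ultimately show ?thesis
    using covers_reflect[OF b, of "affine_reflection b \<mu>" "affine_reflection b \<nu>"]
    by (simp add: affine_pairing_reflected_self[OF b])
qed

text \<open>The function \<open>G\<close>, the height of \<open>x\<close> plus the height of its reflection in \<open>b\<close>, decreases strictly
  along every step whose label is not \<open>b\<close>, because the reflection keeps such labels positive. It
  takes the same value at both ends of the step labeled by \<open>b\<close>, so a chain between them can only use
  the label \<open>b\<close>.\<close>

lemma covers_simple:
  assumes b: "b \<in> affine_simple" and x: "x \<in> orbit" "affine_pairing b x > 0"
  shows "covers x (affine_reflection b x)"
proof -
  define G where "G y = affine_height y + affine_height (affine_reflection b y)" for y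
  have G_step: "G \<nu> \<le> G \<mu> \<and> (G \<nu> = G \<mu> \<longrightarrow> \<nu> = affine_reflection b \<mu>)" if "step \<mu> \<nu>" for \<mu> \<nu>
    using that
  proof (rule stepE)
    fix \<beta> assume \<beta>: "\<beta> \<in> affine_positive" "affine_pairing \<beta> \<mu> > 0" "\<nu> = affine_reflection \<beta> \<mu>"
    show ?thesis
    proof (cases "\<beta> = b")
      case True
      then show ?thesis
        using \<beta> by (simp add: G_def)
    next
      case False
      have "affine_reflection b \<nu> = affine_reflection b \<mu> - affine_pairing \<beta> \<mu> *\<^sub>R affine_reflection b \<beta>"
        unfolding \<beta>(3) affine_reflection_conjugate[of b \<beta>]
        by (simp only: affine_reflection_def[of "affine_reflection b \<beta>"] affine_pairing_reflections)
      then have "affine_height (affine_reflection b \<nu>) =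
          affine_height (affine_reflection b \<mu>) - affine_pairing \<beta> \<mu> * affine_height (affine_reflection b \<beta>)"
        by (simp only: affine_height_linear)
      moreover have "affine_height \<nu> = affine_height \<mu> - affine_pairing \<beta> \<mu> * affine_height \<beta>"
        unfolding \<beta>(3) affine_reflection_def[of \<beta>] by (simp only: affine_height_linear)
      ultimately have "G \<nu> = G \<mu> - affine_pairing \<beta> \<mu> * (affine_height \<beta> + affine_height (affine_reflection b \<beta>))"
        by (simp add: G_def algebra_simps)
      moreover have "affine_pairing \<beta> \<mu> * (affine_height \<beta> + affine_height (affine_reflection b \<beta>)) > 0"
        using \<beta> affine_height_positive[of \<beta>] affine_height_positive[OF affine_simple_permutes[OF b \<beta>(1) False]]
        by simp
      ultimately show ?thesis
        by linarith
    qed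
  qed
  have G_le: "G \<nu> \<le> G \<mu>" if "step\<^sup>*\<^sup>* \<mu> \<nu>" for \<mu> \<nu>
    using that by (induction rule: rtranclp_induct) (auto dest!: G_step)
  have "False" if \<kappa>: "below x \<kappa>" "below \<kappa> (affine_reflection b x)" for \<kappa>
  proof -
    obtain y where y: "step x y" "step\<^sup>*\<^sup>* y \<kappa>"
      using \<kappa>(1) unfolding level_zero_less_def by (blast dest: tranclpD)
    have "below y (affine_reflection b x)"
      using y(2) \<kappa>(2) by (rule le_below_trans)
    then have "G (affine_reflection b x) \<le> G y"
      using G_le below_imp_le by blast
    then have "y = affine_reflection b x"
      using G_step[OF y(1)] by (simp add: G_def)
    then show False
      using \<open>below y (affine_reflection b x)\<close> below_irreflexive by blast
  qed
  then show ?thesis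
    using step_imp_below[OF simple_step_up[OF b x]] unfolding level_zero_covers_def by blast
qed

text \<open>By induction on the height of \<open>\<beta>\<close>. Let \<open>b\<close> be an affine simple root that makes an acute angle with
  \<open>\<beta>\<close>; then the pairing of \<open>b\<close> with \<open>\<nu>\<close> is smaller than its pairing with \<open>\<mu>\<close>. If both pairings are
  nonzero of the same sign, reflecting in \<open>b\<close> changes neither side of the equivalence. Otherwise
  the step factors through the reflections of \<open>\<mu>\<close> and \<open>\<nu>\<close>, and the length gain exceeds that of
  the reflected step.\<close>

theorem covers_iff_length_gain:
  assumes "\<beta> \<in> affine_positive" "\<mu> \<in> orbit" "affine_pairing \<beta> \<mu> > 0"
  shows "length_gain \<beta> (fst \<mu>) \<ge> 1 \<and>
    (covers \<mu> (affine_reflection \<beta> \<mu>) \<longleftrightarrow> length_gain \<beta> (fst \<mu>) = 1)"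
proof -
  have "\<mu> \<in> orbit \<and> affine_pairing \<beta> \<mu> > 0 \<longrightarrow> length_gain \<beta> (fst \<mu>) \<ge> 1 \<and>
    (covers \<mu> (affine_reflection \<beta> \<mu>) \<longleftrightarrow> length_gain \<beta> (fst \<mu>) = 1)"
    using assms(1)
  proof (induction \<beta> \<mu> rule: affine_root_induct)
    case (simple b \<mu>)
    have sgn: "sgn (affine_pairing b \<mu>) = sgn (fst b \<bullet> fst \<mu>)"
      unfolding affine_pairing_def
      using simple by (intro sgn_coroot_inner affine_root_nonzero affine_simple_positive)
    show ?case
      using simple covers_simple[OF simple, of \<mu>] length_gain_simple[OF simple, of "fst \<mu>"] sgn by auto
  next
    case (reflect \<beta> b \<mu>)
    note b = reflect.hyps(2)
    let ?r = "affine_reflection b"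
    let ?\<nu> = "affine_reflection \<beta> \<mu>"
    show ?case
    proof
      assume \<mu>: "\<mu> \<in> orbit \<and> affine_pairing \<beta> \<mu> > 0"
      have \<nu>: "?\<nu> \<in> orbit"
        using \<mu> reflect.hyps(1) orbit_affine_reflection by blast
      have r\<mu>: "?r \<mu> \<in> orbit" 
        using \<mu> b affine_simple_positive orbit_affine_reflection by blast
      let ?p = "affine_pairing b \<mu>" and ?q = "affine_pairing b ?\<nu>"
      have "?q < ?p"
        using \<mu> reflect.hyps(4) by (simp add: affine_pairing_reflected)
      have IH: "length_gain (?r \<beta>) (fst (?r \<mu>)) \<ge> 1"
        "covers (?r \<mu>) (?r ?\<nu>) \<longleftrightarrow> length_gain (?r \<beta>) (fst (?r \<mu>)) = 1"
        using reflect.IH \<mu> r\<mu> by (simp_all add: affine_pairing_reflections affine_reflection_conjugate[of b \<beta>])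
      have sgn: "sgn (fst b \<bullet> fst x) = sgn (affine_pairing b x)" for x :: "'a \<times> real"
        unfolding affine_pairing_def
        using b by (intro sgn_coroot_inner[symmetric] affine_root_nonzero affine_simple_positive)
      have gain: "length_gain \<beta> (fst \<mu>) = length_gain (?r \<beta>) (fst (?r \<mu>)) + sgn ?p - sgn ?q"
        using length_gain_conjugate[OF b, of \<beta> "fst \<mu>"] reflect.hyps(1) sgn[of \<mu>] sgn[of ?\<nu>]
        by (simp add: affine_reflection_pair affine_positive_iff)
      show "length_gain \<beta> (fst \<mu>) \<ge> 1 \<and> (covers \<mu> ?\<nu> \<longleftrightarrow> length_gain \<beta> (fst \<mu>) = 1)"
      proof (cases "sgn ?p = sgn ?q")
        case True
        then have "?p \<noteq> 0"
          using \<open>?q < ?p\<close> by (metis less_irrefl sgn_zero_iff)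
        then show ?thesis
          using gain IH True covers_reflect_iff[OF b True] by simp
      next
        case False
        have "sgn ?p \<ge> sgn ?q"
          using \<open>?q < ?p\<close> by (auto simp: sgn_if)
        then have gain: "length_gain \<beta> (fst \<mu>) > 1"
          using gain IH(1) False by simp
        \<comment> \<open>As the signs differ, the pairing with \<open>b\<close> is positive at \<open>\<mu>\<close> or negative at \<open>\<nu>\<close>; so \<open>r \<mu>\<close> lies
          strictly above \<open>\<mu>\<close> or \<open>r \<nu>\<close> lies strictly below \<open>\<nu>\<close>.\<close>
        have reflected: "below (?r \<mu>) (?r ?\<nu>)"
          using step_conjugate[OF b reflect.hyps(1,3)] \<mu> step_imp_below by blast
        consider "?p > 0" "?q \<le> 0" | "?p = 0" "?q < 0"
          using \<open>?q < ?p\<close> False by (cases "?p > 0"; cases "?q > 0"; cases "?p < 0"; cases "?q < 0") auto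
        then have "\<not> covers \<mu> ?\<nu>"
        proof cases
          case 1
          have "below (?r \<mu>) ?\<nu>"
          proof (cases "?q = 0")
            case True
            then show ?thesis
              using reflected affine_reflection_fixed by metis
          next
            case False
            then show ?thesis
              using reflected 1 simple_step_down[OF b \<nu>] step_imp_below below_trans by fastforce
          qed
          moreover have "below \<mu> (?r \<mu>)"
            using 1 \<mu> simple_step_up[OF b] step_imp_below by blast
          ultimately show ?thesis
            unfolding level_zero_covers_def by blast
        next
          case 2
          then have "below \<mu> (?r ?\<nu>)"
            using reflected affine_reflection_fixed by metis
          moreover have "below (?r ?\<nu>) ?\<nu>"
            using 2 simple_step_down[OF b \<nu>] step_imp_below by blast
          ultimately show ?thesis
            unfolding level_zero_covers_def by blast
        qed
        then show ?thesis
          using gain by simp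
      qed
    qed
  qed
  then show ?thesis
    using assms by blast
qed

text \<open>The pairing is positive because the affine height drops from \<open>\<mu>\<close> to \<open>\<nu>\<close>.\<close>

lemma labeled_coverD:
  assumes "labeled_cover \<Phi> \<Delta> \<Lambda> \<mu> \<beta> \<nu>"
  shows "\<mu> \<in> orbit" "\<beta> \<in> affine_positive" "affine_pairing \<beta> \<mu> > 0" "\<nu> = affine_reflection \<beta> \<mu>"
    "length_gain \<beta> (fst \<mu>) = 1"
proof -
  have below: "below \<mu> \<nu>" and covers: "covers \<mu> \<nu>"
    using assms by (auto simp: labeled_cover_def level_zero_covers_def)
  show \<mu>: "\<mu> \<in> orbit"
    using below below_orbit by blast
  show \<beta>: "\<beta> \<in> affine_positive" and \<nu>: "\<nu> = affine_reflection \<beta> \<mu>"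
    using assms by (auto simp: labeled_cover_def)
  have "affine_pairing \<beta> \<mu> * affine_height \<beta> > 0"
    using below_height[OF below] by (simp add: \<nu> affine_reflection_def affine_height_linear)
  then show pos: "affine_pairing \<beta> \<mu> > 0"
    using affine_height_positive[OF \<beta>] zero_less_mult_pos2 by blast
  show "length_gain \<beta> (fst \<mu>) = 1"
    using covers_iff_length_gain[OF \<beta> \<mu> pos] covers \<nu> by simp
qed

text \<open>Raising the coefficient of \<open>\<delta>\<close> in the label by one raises the length gain by a positive amount,
  so a cover has the smallest coefficient for which the label is positive.\<close>

lemma cover_label_level:
  assumes cover: "labeled_cover \<Phi> \<Delta> \<Lambda> \<mu> \<beta> \<nu>"
  shows "snd \<beta> = 0 \<and> fst \<beta> \<in> \<Phi>p \<or> snd \<beta> = 1 \<and> - fst \<beta> \<in> \<Phi>p"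
proof -
  note c = labeled_coverD[OF cover]
  obtain \<alpha> x where \<beta>: "\<beta> = (\<alpha>, x)"
    by (cases \<beta>)
  have \<alpha>: "\<alpha> \<in> \<Phi>" and x: "x \<in> \<int>" "x > 0 \<or> x = 0 \<and> \<alpha> \<in> \<Phi>p"
    using c(2) by (auto simp: \<beta> affine_positive_iff)
  have inner: "\<alpha> \<bullet> fst \<mu> > 0"
    using c(3) coroot_inner_pos_iff(1)[OF root_nonzero[OF \<alpha>]] by (simp add: \<beta> affine_pairing_def)
  have minimal: "x \<le> y" if "(\<alpha>, y) \<in> affine_positive" for y
  proof -
    have "length_gain (\<alpha>, y) (fst \<mu>) \<ge> 1"
      using covers_iff_length_gain[OF that c(1)] c(3) by (simp add: \<beta> affine_pairing_def)
    then have "(y - x) * (coroot \<alpha> \<bullet> positive_sum (fst \<mu>)) \<ge> 0"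
      using c(5) by (simp add: \<beta> length_gain_def algebra_simps)
    then show ?thesis
      using coroot_positive_sum[OF \<alpha> inner] by (simp add: zero_le_mult_iff)
  qed
  consider "\<alpha> \<in> \<Phi>p" | "- \<alpha> \<in> \<Phi>p"
    using positive_or_negative[OF \<alpha>] by blast
  then show ?thesis
  proof cases
    case 1
    then have "x \<le> 0"
      by (intro minimal) (simp add: affine_positive_iff \<alpha>)
    then show ?thesis
      using x 1 by (auto simp: \<beta>)
  next
    case 2
    then have "x \<le> 1"
      by (intro minimal) (simp add: affine_positive_iff \<alpha>)
    moreover have "x > 0"
      using x 2 not_positive_and_negative[of \<alpha>] by auto
    ultimately have "x = 1"
      using x(1) by (elim Ints_cases) simp
    then show ?thesis
      using 2 by (simp add: \<beta>)
  qed
qed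


section \<open>Covers and edges\<close>

lemma length_gain_edge:
  assumes w: "w \<in> min_reps \<Delta> J" and \<gamma>: "\<gamma> \<in> \<Phi>"
  shows "length_gain (w \<gamma>, n) (w \<Lambda>) =
    real (weyl_length \<Delta> (min_rep \<Delta> J (w \<circ> root_reflection \<gamma>))) - real (weyl_length \<Delta> w)
      + n * (coroot \<gamma> \<bullet> (2 *\<^sub>R rho \<Phi> \<Delta> - 2 *\<^sub>R rho_parabolic \<Phi> \<Delta> J))"
proof -
  note W = min_rep_weyl[OF w]
  have x: "w \<circ> root_reflection \<gamma> \<in> weyl \<Delta>"
    using weyl_comp[OF W reflection_in_weyl[OF \<gamma>]] .
  have "weyl_length \<Delta> (min_rep \<Delta> J (w \<circ> root_reflection \<gamma>)) = inversions (root_reflection (w \<gamma>) (w \<Lambda>))"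
    using min_rep_length[OF min_rep_works(1)[OF x]] min_rep_works(3)[OF x]
      orthogonal_conjugates_reflection[OF weyl_orthogonal[OF W], of \<gamma> \<Lambda>] by simp
  moreover have "coroot (w \<gamma>) \<bullet> positive_sum (w \<Lambda>) = coroot \<gamma> \<bullet> positive_sum \<Lambda>"
    by (simp add: orthogonal_coroot[OF weyl_orthogonal[OF W]] weyl_inner[OF W]
        positive_sum_equivariant[OF weyl_orthogonal[OF W] weyl_roots[OF W]])
  ultimately show ?thesis
    by (simp add: length_gain_def min_rep_length[OF w] positive_sum_dominant)
qed

lemma cl_reflection:
  assumes \<mu>: "\<mu> \<in> orbit" and w: "w = cl \<Delta> \<Lambda> \<mu>" and \<gamma>: "\<gamma> \<in> \<Phi>" and n: "n \<in> \<int>"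
  shows "cl \<Delta> \<Lambda> (affine_reflection (w \<gamma>, n) \<mu>) = min_rep \<Delta> J (w \<circ> root_reflection \<gamma>)"
proof -
  have rep: "w \<in> min_reps \<Delta> J" and fst\<mu>: "fst \<mu> = w \<Lambda>"
    using cl_orbit[OF \<mu>] w by simp_all
  note W = min_rep_weyl[OF rep]
  have x: "w \<circ> root_reflection \<gamma> \<in> weyl \<Delta>"
    using weyl_comp[OF W reflection_in_weyl[OF \<gamma>]] .
  have "affine_reflection (w \<gamma>, n) \<mu> \<in> orbit"
    using orbit_reflection[OF \<mu>, of "(w \<gamma>, n)"] weyl_root[OF W \<gamma>] n by simp
  then have "snd (affine_reflection (w \<gamma>, n) \<mu>) \<in> \<int>"
    by (rule orbit_level_integral)
  then show ?thesis
    using min_rep_works[OF x] orthogonal_conjugates_reflection[OF weyl_orthogonal[OF W], of \<gamma> \<Lambda>]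
    by (intro cl_eq) (simp_all add: affine_reflection_pair fst\<mu>)
qed

lemma affine_pairing_pos_iff:
  assumes "w \<in> weyl \<Delta>" "fst \<mu> = w \<Lambda>" "\<gamma> \<in> \<Phi>"
  shows "affine_pairing (w \<gamma>, n) \<mu> > 0 \<longleftrightarrow> \<gamma> \<bullet> \<Lambda> > 0"
  using coroot_inner_pos_iff(1)[OF root_nonzero[OF assms(3)]]
  by (simp add: affine_pairing_def assms(2) orthogonal_coroot[OF weyl_orthogonal[OF assms(1)]]
      weyl_inner[OF assms(1)])

lemma labeled_cover_iff:
  assumes \<mu>: "\<mu> \<in> orbit" and w: "w = cl \<Delta> \<Lambda> \<mu>"
    and \<gamma>: "\<gamma> \<in> \<Phi>" "\<gamma> \<bullet> \<Lambda> > 0" and pos: "(w \<gamma>, n) \<in> affine_positive"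
  shows "length_gain (w \<gamma>, n) (w \<Lambda>) \<ge> 1"
    "labeled_cover \<Phi> \<Delta> \<Lambda> \<mu> (w \<gamma>, n) (affine_reflection (w \<gamma>, n) \<mu>) \<longleftrightarrow>
       length_gain (w \<gamma>, n) (w \<Lambda>) = 1"
proof -
  have fst\<mu>: "fst \<mu> = w \<Lambda>" and W: "w \<in> weyl \<Delta>"
    using cl_orbit[OF \<mu>] w min_rep_weyl by simp_all
  have "affine_pairing (w \<gamma>, n) \<mu> > 0"
    using affine_pairing_pos_iff[OF W fst\<mu> \<gamma>(1)] \<gamma>(2) by simp
  from covers_iff_length_gain[OF pos \<mu> this]
  show "length_gain (w \<gamma>, n) (w \<Lambda>) \<ge> 1"
    "labeled_cover \<Phi> \<Delta> \<Lambda> \<mu> (w \<gamma>, n) (affine_reflection (w \<gamma>, n) \<mu>) \<longleftrightarrow>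
       length_gain (w \<gamma>, n) (w \<Lambda>) = 1"
    using pos by (simp_all add: fst\<mu> labeled_cover_def)
qed

theorem cover_imp_edge:
  assumes \<mu>: "\<mu> \<in> orbit" and w: "w = cl \<Delta> \<Lambda> \<mu>" and cover: "labeled_cover \<Phi> \<Delta> \<Lambda> \<mu> \<beta> \<nu>"
  shows "(\<beta> \<in> of_finite ` \<Phi>p \<and> bruhat_edge \<Phi> \<Delta> J w (inv w (fst \<beta>)) (cl \<Delta> \<Lambda> \<nu>)) \<or>
    (\<beta> \<in> (\<lambda>\<alpha>. \<delta> - of_finite \<alpha>) ` \<Phi>p \<and>
       quantum_edge \<Phi> \<Delta> J w (inv w (fst (\<beta> - \<delta>))) (cl \<Delta> \<Lambda> \<nu>))"
proof -
  have rep: "w \<in> min_reps \<Delta> J" and fst\<mu>: "fst \<mu> = w \<Lambda>"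
    using cl_orbit[OF \<mu>] w by simp_all
  note W = min_rep_weyl[OF rep]
  note c = labeled_coverD[OF cover]
  define \<gamma> where "\<gamma> = inv w (fst \<beta>)"
  obtain n where \<beta>: "\<beta> = (w \<gamma>, n)" and n: "n \<in> \<int>"
    using c(2) by (cases \<beta>) (auto simp: \<gamma>_def weyl_inv_apply[OF W] affine_positive_iff)
  have \<gamma>: "\<gamma> \<in> \<Phi>"
    using weyl_root[OF weyl_inv[OF W]] c(2) by (simp add: \<gamma>_def affine_positive_iff)
  have inner: "\<gamma> \<bullet> \<Lambda> > 0"
    using affine_pairing_pos_iff[OF W fst\<mu> \<gamma>] c(3) by (simp add: \<beta>)
  then have label: "\<gamma> \<in> \<Phi>p - parabolic_positive_roots \<Phi> \<Delta> J"
    using \<gamma> nonparabolic_positive_iff by blast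
  have target: "cl \<Delta> \<Lambda> \<nu> = min_rep \<Delta> J (w \<circ> root_reflection \<gamma>)"
    using cl_reflection[OF \<mu> w \<gamma> n] c(4) by (simp add: \<beta>)
  note gain = length_gain_edge[OF rep \<gamma>, of n]
  have gain1: "length_gain (w \<gamma>, n) (w \<Lambda>) = 1"
    using c(5) by (simp add: \<beta> fst\<mu>)
  from cover_label_level[OF cover] consider "n = 0" "w \<gamma> \<in> \<Phi>p" | "n = 1" "- w \<gamma> \<in> \<Phi>p"
    by (auto simp: \<beta>)
  then show ?thesis
  proof cases
    case 1
    have "root_reflection (w \<gamma>) (w \<Lambda>) = w (root_reflection \<gamma> \<Lambda>)"
      using orthogonal_conjugates_reflection[OF weyl_orthogonal[OF W]] by simp
    then have "inversions (w (root_reflection \<gamma> \<Lambda>)) = inversions (w \<Lambda>) + 1"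
      using gain1 1(1) by (simp add: length_gain_def)
    then have "weyl_length \<Delta> (w \<circ> root_reflection \<gamma>) = weyl_length \<Delta> w + 1"
      using min_rep_reflection_length[OF rep \<gamma> inner 1(2)] by blast
    then have "bruhat_edge \<Phi> \<Delta> J w \<gamma> (cl \<Delta> \<Lambda> \<nu>)"
      unfolding bruhat_edge_def using rep label target by blast
    moreover have "\<beta> \<in> of_finite ` \<Phi>p"
      using 1 by (auto simp: \<beta> of_finite_def)
    ultimately show ?thesis
      by (simp add: \<gamma>_def)
  next
    case 2
    have "quantum_edge \<Phi> \<Delta> J w \<gamma> (cl \<Delta> \<Lambda> \<nu>)"
      unfolding quantum_edge_def using rep label target gain gain1 2(1) by simp
    moreover have "\<beta> = \<delta> - of_finite (- w \<gamma>)"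
      using 2 by (simp add: \<beta> of_finite_def \<delta>_def)
    then have "\<beta> \<in> (\<lambda>\<alpha>. \<delta> - of_finite \<alpha>) ` \<Phi>p"
      using 2(2) by (rule image_eqI)
    moreover have "inv w (fst (\<beta> - \<delta>)) = \<gamma>"
      by (simp add: \<beta> \<delta>_def weyl_inv_apply[OF W])
    ultimately show ?thesis
      by simp
  qed
qed

text \<open>The minimal representative of \<open>w r\<^sub>\<gamma>\<close> is at most as long as \<open>w r\<^sub>\<gamma>\<close>, so the step gains at most one;
  and every step gains at least one.\<close>

theorem bruhat_edge_imp_cover:
  assumes \<mu>: "\<mu> \<in> orbit" and w: "w = cl \<Delta> \<Lambda> \<mu>" and edge: "bruhat_edge \<Phi> \<Delta> J w \<gamma> w'"
  shows "\<exists>\<nu>. labeled_cover \<Phi> \<Delta> \<Lambda> \<mu> (of_finite (w \<gamma>)) \<nu> \<and> cl \<Delta> \<Lambda> \<nu> = w'"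
proof -
  have rep: "w \<in> min_reps \<Delta> J" and \<gamma>: "\<gamma> \<in> \<Phi>" "\<gamma> \<bullet> \<Lambda> > 0" and \<gamma>_pos: "\<gamma> \<in> \<Phi>p"
    and target: "w' = min_rep \<Delta> J (w \<circ> root_reflection \<gamma>)"
    and length: "weyl_length \<Delta> (w \<circ> root_reflection \<gamma>) = weyl_length \<Delta> w + 1"
    using edge nonparabolic_positive_iff[of \<gamma>] unfolding bruhat_edge_def by auto
  note W = min_rep_weyl[OF rep]
  have x: "w \<circ> root_reflection \<gamma> \<in> weyl \<Delta>"
    using weyl_comp[OF W reflection_in_weyl[OF \<gamma>(1)]] .
  \<comment> \<open>otherwise the reflection would shorten \<open>w\<close>\<close>
  have "w \<gamma> \<in> \<Phi>p"
    using weyl_length_reflection_less[OF W \<gamma>_pos] length positive_or_negative[OF weyl_root[OF W \<gamma>(1)]]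
    by auto
  then have pos: "(w \<gamma>, 0) \<in> affine_positive"
    by (simp add: affine_positive_iff positive_is_root)
  note cover = labeled_cover_iff[OF \<mu> w \<gamma> pos]
  have "length_gain (w \<gamma>, 0) (w \<Lambda>) \<le> 1"
    using length_gain_edge[OF rep \<gamma>(1), of 0] min_rep_length_le[OF x] length by simp
  then have "labeled_cover \<Phi> \<Delta> \<Lambda> \<mu> (w \<gamma>, 0) (affine_reflection (w \<gamma>, 0) \<mu>)"
    using cover by simp
  then show ?thesis
    using cl_reflection[OF \<mu> w \<gamma>(1), of 0] target
    by (intro exI[of _ "affine_reflection (w \<gamma>, 0) \<mu>"]) (simp add: of_finite_def)
qed

theorem quantum_edge_imp_cover:
  assumes \<mu>: "\<mu> \<in> orbit" and w: "w = cl \<Delta> \<Lambda> \<mu>" and edge: "quantum_edge \<Phi> \<Delta> J w \<gamma> w'"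
  shows "\<exists>\<nu>. labeled_cover \<Phi> \<Delta> \<Lambda> \<mu> (\<delta> + of_finite (w \<gamma>)) \<nu> \<and> cl \<Delta> \<Lambda> \<nu> = w'"
proof -
  have rep: "w \<in> min_reps \<Delta> J" and \<gamma>: "\<gamma> \<in> \<Phi>" "\<gamma> \<bullet> \<Lambda> > 0"
    and target: "w' = min_rep \<Delta> J (w \<circ> root_reflection \<gamma>)"
    and length: "real (weyl_length \<Delta> (min_rep \<Delta> J (w \<circ> root_reflection \<gamma>))) =
       real (weyl_length \<Delta> w) + 1 - coroot \<gamma> \<bullet> (2 *\<^sub>R rho \<Phi> \<Delta> - 2 *\<^sub>R rho_parabolic \<Phi> \<Delta> J)"
    using edge nonparabolic_positive_iff[of \<gamma>] unfolding quantum_edge_def by auto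
  have pos: "(w \<gamma>, 1) \<in> affine_positive"
    using weyl_root[OF min_rep_weyl[OF rep] \<gamma>(1)] by (simp add: affine_positive_iff)
  have "labeled_cover \<Phi> \<Delta> \<Lambda> \<mu> (w \<gamma>, 1) (affine_reflection (w \<gamma>, 1) \<mu>)"
    using labeled_cover_iff(2)[OF \<mu> w \<gamma> pos] length_gain_edge[OF rep \<gamma>(1), of 1] length by simp
  then show ?thesis
    using cl_reflection[OF \<mu> w \<gamma>(1), of 1] target
    by (intro exI[of _ "affine_reflection (w \<gamma>, 1) \<mu>"]) (simp add: of_finite_def \<delta>_def)
qed

end

theorem theorem6p5:
  fixes \<Phi> \<Delta> J :: "'a::euclidean_space set" and \<Lambda> :: 'a
    and \<mu> :: "'a \<times> real" and w :: "'a \<Rightarrow> 'a"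
  assumes "irreducible_root_system \<Phi>" and "simple_system \<Phi> \<Delta>"
    and "\<Lambda> \<in> weight_lattice \<Phi>" and "dominant \<Delta> \<Lambda>"
    and "J = stabilizer_nodes \<Delta> \<Lambda>"
    and "\<mu> \<in> level_zero_orbit \<Phi> \<Delta> \<Lambda>" and "w = cl \<Delta> \<Lambda> \<mu>"
  shows
    "(\<forall>\<beta> \<nu>. labeled_cover \<Phi> \<Delta> \<Lambda> \<mu> \<beta> \<nu> \<longrightarrow>
        (\<beta> \<in> of_finite ` positive_roots \<Phi> \<Delta> \<and>
           bruhat_edge \<Phi> \<Delta> J w (inv w (fst \<beta>)) (cl \<Delta> \<Lambda> \<nu>)) \<or>
        (\<beta> \<in> (\<lambda>\<alpha>. \<delta> - of_finite \<alpha>) ` positive_roots \<Phi> \<Delta> \<and>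
           quantum_edge \<Phi> \<Delta> J w (inv w (fst (\<beta> - \<delta>))) (cl \<Delta> \<Lambda> \<nu>))) \<and>
     (\<forall>\<gamma> w'. bruhat_edge \<Phi> \<Delta> J w \<gamma> w' \<longrightarrow>
        (\<exists>\<nu>. labeled_cover \<Phi> \<Delta> \<Lambda> \<mu> (of_finite (w \<gamma>)) \<nu> \<and> cl \<Delta> \<Lambda> \<nu> = w')) \<and>
     (\<forall>\<gamma> w'. quantum_edge \<Phi> \<Delta> J w \<gamma> w' \<longrightarrow>
        (\<exists>\<nu>. labeled_cover \<Phi> \<Delta> \<Lambda> \<mu> (\<delta> + of_finite (w \<gamma>)) \<nu> \<and> cl \<Delta> \<Lambda> \<nu> = w'))"
proof -
  interpret roots: based_root_system \<Phi> \<Delta>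
    using assms(1,2) by unfold_locales (simp_all add: irreducible_root_system_def)
  obtain \<theta> where "roots.highest \<theta>"
    using roots.exists_highest_root[OF assms(1)] by blast
  then interpret level_zero_poset \<Phi> \<Delta> \<theta> \<Lambda>
    using assms(3,4) by unfold_locales
  show ?thesis
    unfolding assms(5)
    using cover_imp_edge[OF assms(6,7)] bruhat_edge_imp_cover[OF assms(6,7)]
      quantum_edge_imp_cover[OF assms(6,7)]
    by blast
qed

end
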